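(* Let $\delta\in\{1,-1\}$ and let $y_1 = x_1^2x_2x_1^{2\delta}x_2^{-1}$ in the free group $F_2$ on $x_1,x_2$; for $k\in\mathbb{Z}$ write $y_k=y_1^k$. Let $\varepsilon\in\{1,-1\}$, let $k$ be an integer, and put $k_\varepsilon = k-\frac12+\frac{\varepsilon}{2}$ (so $k_\varepsilon=k$ if $\varepsilon=1$ and $k_\varepsilon=k-1$ if $\varepsilon=-1$). Assume $k_\varepsilon\ge 1$. Let $p$ be a prime and $n$ a positive integer such that: (1) the integer $2$ is not a square modulo $p$; (2) $n$ is odd; (3) for every $1\le i\le k_\varepsilon$, the inertia degree $f_i$ of $p$ in the extension $\mathbb{Q}(\zeta_{2k_\varepsilon+1}^i+\zeta_{2k_\varepsilon+1}^{-i})/\mathbb{Q}$ does not divide $n$. Let $w$ be either of the words $x_1^{2\varepsilon}y_k$, $x_1^2y_{\varepsilon k}$. Then the word map $(x,y)\mapsto w(x,y)$ is not surjective on $\mathrm{PSL}_2(\mathbb{F}_{p^n})$.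
   Context: For a positive integer $m$, $\zeta_m=e^{2\pi i/m}$. A word $w\in F_2=\langle x_1,x_2\rangle$ induces on any group $G$ the word map $G\times G\to G$, $(x,y)\mapsto w(x,y)$, obtained by substituting $x_1=x$, $x_2=y$. The inertia degree of $p$ in a Galois extension $E/\mathbb{Q}$ is the degree over $\mathbb{F}_p$ of the residue field of $\mathcal{O}_E$ at any prime above $p$ (independent of the choice of prime). *)

theory Defs
  imports
    "HOL-Analysis.Analysis"
    "HOL-Algebra.Algebra"
    "HOL-Algebra.Algebraic_Closure_Type"
    "HOL-Number_Theory.Residues"
    "HOL-Computational_Algebra.Polynomial"
begin

section \<open>Free groups and word maps\<close>

text \<open>
  The free group is realised on freely reduced words. The letter \<open>(g, False)\<close> stands for the
  generator \<open>g\<close> and \<open>(g, True)\<close> for its inverse.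
\<close>

type_synonym 'g word = "('g \<times> bool) list"

definition inv_letter :: "'g \<times> bool \<Rightarrow> 'g \<times> bool" where
  "inv_letter a = (fst a, \<not> snd a)"

definition freely_reduced :: "'g word \<Rightarrow> bool" where
  "freely_reduced w \<longleftrightarrow> successively (\<lambda>a b. b \<noteq> inv_letter a) w"

definition cons_reduce :: "'g \<times> bool \<Rightarrow> 'g word \<Rightarrow> 'g word" where
  "cons_reduce a w = (if w \<noteq> [] \<and> hd w = inv_letter a then tl w else a # w)"

definition free_group :: "'g word monoid" where
  "free_group = \<lparr>carrier = {w. freely_reduced w}, mult = foldr cons_reduce, one = []\<rparr>"

definition word_eval :: "('a, 'b) monoid_scheme \<Rightarrow> ('g \<Rightarrow> 'a) \<Rightarrow> 'g word \<Rightarrow> 'a" where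
  "word_eval G f w =
     foldr (\<lambda>(g, b) z. (if b then inv\<^bsub>G\<^esub> (f g) else f g) \<otimes>\<^bsub>G\<^esub> z) w \<one>\<^bsub>G\<^esub>"

lemma inv_letter_inv_letter [simp]: "inv_letter (inv_letter a) = a"
  by (simp add: inv_letter_def)

lemma inv_letter_neq [simp]: "inv_letter a \<noteq> a" "a \<noteq> inv_letter a"
  by (auto simp: inv_letter_def prod_eq_iff)

lemma freely_reduced_Cons:
  "freely_reduced (a # w) \<longleftrightarrow> freely_reduced w \<and> (w \<noteq> [] \<longrightarrow> hd w \<noteq> inv_letter a)"
  by (cases w) (auto simp: freely_reduced_def)

lemma freely_reduced_Nil [simp]: "freely_reduced []"
  by (simp add: freely_reduced_def)

lemma freely_reduced_cons_reduce: "freely_reduced w \<Longrightarrow> freely_reduced (cons_reduce a w)"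
  by (cases w) (auto simp: cons_reduce_def freely_reduced_Cons)

lemma freely_reduced_foldr: "freely_reduced v \<Longrightarrow> freely_reduced (foldr cons_reduce u v)"
  by (induction u) (auto simp: freely_reduced_cons_reduce)

lemma cons_reduce_cancel:
  "freely_reduced w \<Longrightarrow> cons_reduce (inv_letter a) (cons_reduce a w) = w"
  "freely_reduced w \<Longrightarrow> cons_reduce a (cons_reduce (inv_letter a) w) = w"
  by (cases w; auto simp: cons_reduce_def freely_reduced_Cons neq_Nil_conv)+

lemma foldr_cons_reduce_push:
  assumes "freely_reduced w"
  shows "foldr cons_reduce (cons_reduce a v) w = cons_reduce a (foldr cons_reduce v w)"
  using assms
proof (cases "v \<noteq> [] \<and> hd v = inv_letter a")
  case True
  then obtain u where "v = inv_letter a # u"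
    by (cases v) auto
  then show ?thesis
    using assms by (simp add: cons_reduce_def[of a "_ # _"] cons_reduce_cancel freely_reduced_foldr)
next
  case False
  then have "cons_reduce a v = a # v"
    by (auto simp: cons_reduce_def)
  then show ?thesis
    by simp
qed

lemma foldr_cons_reduce_assoc:
  assumes "freely_reduced w"
  shows "foldr cons_reduce (foldr cons_reduce u v) w = foldr cons_reduce u (foldr cons_reduce v w)"
  by (induction u) (auto simp: foldr_cons_reduce_push assms)

lemma foldr_cons_reduce_Nil: "freely_reduced w \<Longrightarrow> foldr cons_reduce w [] = w"
  by (induction w) (auto simp: freely_reduced_Cons cons_reduce_def)

lemma foldr_cons_reduce_left_inv:
  assumes "freely_reduced v"
  shows "foldr cons_reduce (rev (map inv_letter w)) (foldr cons_reduce w v) = v"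
  using assms by (induction w arbitrary: v) (auto simp: cons_reduce_cancel freely_reduced_foldr)

lemma group_free_group: "group (free_group :: 'g word monoid)"
proof (rule groupI)
  fix w :: "'g word"
  assume "w \<in> carrier free_group"
  then have w: "freely_reduced w"
    by (simp add: free_group_def)
  let ?v = "foldr cons_reduce (rev (map inv_letter w)) []"
  have "foldr cons_reduce ?v w = []"
    using foldr_cons_reduce_left_inv[of "[]" w] w
    by (simp add: foldr_cons_reduce_assoc foldr_cons_reduce_Nil)
  then show "\<exists>v\<in>carrier free_group. v \<otimes>\<^bsub>free_group\<^esub> w = \<one>\<^bsub>free_group\<^esub>"
    by (intro bexI[of _ ?v]) (auto simp: free_group_def freely_reduced_foldr)
qed (auto simp: free_group_def freely_reduced_foldr foldr_cons_reduce_assoc)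

lemma word_eval_closed:
  assumes "group G" "range f \<subseteq> carrier G"
  shows "word_eval G f w \<in> carrier G"
proof -
  interpret group G by fact
  have "f g \<in> carrier G" for g
    using assms(2) by auto
  then show ?thesis
    by (induction w) (auto simp: word_eval_def)
qed

lemma word_eval_hom:
  fixes G (structure)
  assumes "group G" "range f \<subseteq> carrier G"
  shows "word_eval G f \<in> hom free_group G"
proof -
  interpret group G by fact
  have f: "f g \<in> carrier G" for g
    using assms(2) by auto
  note closed = word_eval_closed[OF assms]
  have eval_Cons: "word_eval G f ((g, b) # v) = (if b then inv (f g) else f g) \<otimes> word_eval G f v"
    for g b v by (simp add: word_eval_def)
  have "word_eval G f (cons_reduce (g, b) v) = (if b then inv (f g) else f g) \<otimes> word_eval G f v"
    for g b v
    by (cases v)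
       (auto simp: cons_reduce_def inv_letter_def eval_Cons f closed m_assoc[symmetric])
  then have "word_eval G f (foldr cons_reduce u v) = word_eval G f u \<otimes> word_eval G f v" for u v
  proof (induction u)
    case Nil
    then show ?case using closed by (simp add: word_eval_def[of _ _ "[]"])
  next
    case (Cons a u)
    then show ?case by (cases a) (auto simp: eval_Cons f closed m_assoc)
  qed
  then show ?thesis
    by (auto simp: hom_def free_group_def closed)
qed

datatype gen2 = X1 | X2

abbreviation F2 :: "gen2 word monoid" where
  "F2 \<equiv> free_group"

definition x1 :: "gen2 word" where "x1 = [(X1, False)]"
definition x2 :: "gen2 word" where "x2 = [(X2, False)]"

definition word_map :: "('a, 'b) monoid_scheme \<Rightarrow> gen2 word \<Rightarrow> 'a \<times> 'a \<Rightarrow> 'a" where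
  "word_map G w = (\<lambda>(x, y). word_eval G (case_gen2 x y) w)"

definition y_word :: "int \<Rightarrow> int \<Rightarrow> gen2 word" where
  "y_word \<delta> k =
     (x1 [^]\<^bsub>F2\<^esub> (2::int) \<otimes>\<^bsub>F2\<^esub> x2 \<otimes>\<^bsub>F2\<^esub> x1 [^]\<^bsub>F2\<^esub> (2 * \<delta>) \<otimes>\<^bsub>F2\<^esub> inv\<^bsub>F2\<^esub> x2) [^]\<^bsub>F2\<^esub> k"


section \<open>Projective special linear groups\<close>

definition SL :: "('a::field ^ 'n ^ 'n) monoid" where
  "SL = \<lparr>carrier = {A. det A = 1}, mult = (**), one = mat 1\<rparr>"

definition group_centre :: "('a, 'b) monoid_scheme \<Rightarrow> 'a set" where
  "group_centre G = {z \<in> carrier G. \<forall>g\<in>carrier G. z \<otimes>\<^bsub>G\<^esub> g = g \<otimes>\<^bsub>G\<^esub> z}"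

definition PSL :: "('a::field ^ 'n ^ 'n) set monoid" where
  "PSL = SL Mod group_centre SL"


section \<open>Inertia degrees\<close>

definition zeta :: "nat \<Rightarrow> complex" where
  "zeta m = exp (2 * complex_of_real pi * \<i> / of_nat m)"

abbreviation complex_ring :: "complex ring" where
  "complex_ring \<equiv> ring_of_type_algebra"

definition rat_adjoin :: "complex \<Rightarrow> complex set" where
  "rat_adjoin \<theta> = generate_field complex_ring (insert \<theta> \<rat>)"

definition integer_ring :: "complex set \<Rightarrow> complex ring" where
  "integer_ring E = complex_ring\<lparr>carrier := {x \<in> E. algebraic_int x}\<rparr>"

definition prime_above :: "nat \<Rightarrow> complex set \<Rightarrow> complex set \<Rightarrow> bool" where
  "prime_above p E P \<longleftrightarrow> primeideal P (integer_ring E) \<and> of_nat p \<in> P"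

text \<open>
  \<open>generate_field R {}\<close> is the prime subfield of \<open>R\<close>, which is the copy of $\mathbb{F}_p$ inside
  the residue field of a prime above \<open>p\<close>.
\<close>

definition residue_degree :: "complex set \<Rightarrow> complex set \<Rightarrow> nat" where
  "residue_degree E P =
     (let R = integer_ring E Quot P in ring.dim R (generate_field R {}) (carrier R))"

text \<open>For Galois \<open>E\<close> the residue degree does not depend on the choice of the prime above \<open>p\<close>.\<close>

definition inertia_degree :: "nat \<Rightarrow> complex set \<Rightarrow> nat" where
  "inertia_degree p E = residue_degree E (SOME P. prime_above p E P)"

end

theory Submission
  imports
    Defs
    "HOL-Number_Theory.Euler_Criterion"
    "Jordan_Normal_Form.Char_Poly"
begin

text \<open>
  Put \<open>K = k\<^sub>\<epsilon>\<close> and \<open>q = p ^ n\<close>. For \<open>x\<close>, \<open>y\<close> in \<open>SL\<^sub>2\<close> the elements \<open>x\<^sup>2\<close> and \<open>y x\<^sup>2\<^sup>\<delta> y\<^sup>-\<^sup>1\<close> have equal trace, and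
  the recurrence for traces of powers shows that \<open>w(x, y)\<close> has trace \<open>tr(x\<^sup>2) T(c)\<close>, where
  \<open>c\<close> is the trace of \<open>y\<^sub>1(x, y)\<close> and \<open>T\<close> is the polynomial with
  \<open>T(z + 1/z) = (z ^ (2 K + 1) + 1) / (z ^ K (z + 1))\<close>. Since 2 is not a square, \<open>tr(x\<^sup>2) = tr(x)\<^sup>2 - 2\<close> does
  not vanish. If \<open>T(c) = 0\<close>, then either \<open>z = -1\<close> and \<open>p\<close> divides \<open>2 K + 1\<close>, or \<open>-z\<close> is a nontrivial
  root of unity of order dividing both \<open>2 K + 1\<close> and one of \<open>q - 1\<close>, \<open>q + 1\<close>. So for some divisor
  \<open>m > 1\<close> of \<open>2 K + 1\<close>, either \<open>m = p\<close> or \<open>q\<close> is 1 or -1 modulo \<open>m\<close>. In both cases the \<open>q\<close>-power map is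
  trivial on the residue field of the real subfield of the \<open>m\<close>-th cyclotomic field at \<open>p\<close>, so its
  degree divides \<open>n\<close>, against the hypothesis. Hence no element of trace 0 is hit.
\<close>

section \<open>Algebraic integers\<close>

text \<open>The rings of integers of the real subfields are never determined. Congruences modulo
  \<open>p\<close> are taken in the ring of all algebraic integers instead, and an integer of the
  field becomes an integer polynomial in the root of unity \<open>z\<close> after multiplication by
  \<open>m\<close>. If \<open>p\<close> does not divide \<open>m\<close>, this factor cancels modulo
  \<open>p\<close>. For \<open>m = p\<close> it cannot be cancelled, and Z[z] is shown to contain
  the integers in question. As \<open>p\<close> ramifies there, the congruence holds only after a
  further \<open>p\<close>-th power; this is harmless, because a prime ideal containing a power of
  an element contains the element. The same argument serves every prime above \<open>p\<close>, so
  the choice hidden in \<open>inertia_degree\<close> does not matter. Real subfields appear because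
  for \<open>q\<close> equal to -1 modulo \<open>m\<close> the \<open>q\<close>-power sends
  \<open>z\<close> to its complex conjugate, which fixes real elements only. On the group side, the
  trace of an element of PSL is defined only up to central factors, but these are scalars, so trace
  0 is a meaningful condition.\<close>

definition int_span :: "complex set \<Rightarrow> complex set" where
  "int_span B = range (\<lambda>c. \<Sum>b\<in>B. of_int (c b) * b)"

lemma int_span_base: "finite B \<Longrightarrow> b \<in> B \<Longrightarrow> b \<in> int_span B"
  unfolding int_span_def
  by (rule range_eqI[of _ _ "\<lambda>b'. if b' = b then 1 else 0"]) (simp add: if_distrib if_distribR cong: if_cong)

lemma int_span_0: "0 \<in> int_span B"
  unfolding int_span_def by (rule range_eqI[of _ _ "\<lambda>_. 0"]) simp

lemma int_span_add:
  assumes "u \<in> int_span B" "v \<in> int_span B"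
  shows "u + v \<in> int_span B"
proof -
  obtain c d where "u = (\<Sum>b\<in>B. of_int (c b) * b)" "v = (\<Sum>b\<in>B. of_int (d b) * b)"
    using assms by (auto simp: int_span_def)
  then show ?thesis
    unfolding int_span_def
    by (intro range_eqI[of _ _ "\<lambda>b. c b + d b"]) (simp add: sum.distrib algebra_simps)
qed

lemma int_span_scale:
  assumes "u \<in> int_span B"
  shows "of_int k * u \<in> int_span B"
proof -
  obtain c where "u = (\<Sum>b\<in>B. of_int (c b) * b)"
    using assms by (auto simp: int_span_def)
  then show ?thesis
    unfolding int_span_def
    by (intro range_eqI[of _ _ "\<lambda>b. k * c b"]) (simp add: sum_distrib_left algebra_simps)
qed

lemma int_span_sum: "(\<And>i. i \<in> I \<Longrightarrow> f i \<in> int_span B) \<Longrightarrow> sum f I \<in> int_span B"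
  by (induction I rule: infinite_finite_induct) (auto simp: int_span_0 int_span_add)

lemma int_span_mult:
  assumes "\<And>b. b \<in> B \<Longrightarrow> x * b \<in> int_span B" "u \<in> int_span B"
  shows "x * u \<in> int_span B"
proof -
  obtain c where "u = (\<Sum>b\<in>B. of_int (c b) * b)"
    using assms(2) by (auto simp: int_span_def)
  then have "x * u = (\<Sum>b\<in>B. of_int (c b) * (x * b))"
    by (simp add: sum_distrib_left algebra_simps)
  then show ?thesis
    by (simp add: assms(1) int_span_sum int_span_scale)
qed

text \<open>The determinant trick: the integers expressing each \<open>x * b\<close> in the
  generators form a matrix with eigenvalue \<open>x\<close>. The eigenvector is the list of
  generators, nonzero because it contains 1, and the characteristic polynomial is monic over the
  integers.\<close>

lemma algebraic_int_if_int_span: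
  assumes "finite B" "1 \<in> B" and mult: "\<And>b. b \<in> B \<Longrightarrow> x * b \<in> int_span B"
  shows "algebraic_int x"
proof -
  have "\<forall>b\<in>B. \<exists>c. x * b = (\<Sum>b'\<in>B. of_int (c b') * b')"
    using mult by (auto simp: int_span_def)
  then obtain c where c: "\<And>b. b \<in> B \<Longrightarrow> x * b = (\<Sum>b'\<in>B. of_int (c b b') * b')"
    using bchoice[of B "\<lambda>b c. x * b = (\<Sum>b'\<in>B. of_int (c b') * b')"] by blast
  obtain bs where bs: "set bs = B" "distinct bs"
    using finite_distinct_list[OF \<open>finite B\<close>] by blast
  define N where "N = length bs"
  define M where "M = Matrix.mat N N (\<lambda>(i, j). c (bs ! i) (bs ! j))"
  define v where "v = Matrix.vec N (\<lambda>i. bs ! i)"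
  let ?M = "map_mat of_int M :: complex mat"
  have M: "M \<in> carrier_mat N N" and v: "v \<in> carrier_vec N"
    by (auto simp: M_def v_def)
  have sum_bs: "(\<Sum>j<N. f (bs ! j)) = sum f B" for f :: "complex \<Rightarrow> complex"
    unfolding bs(1)[symmetric] N_def
    using bs(2) by (simp add: sum_list_distinct_conv_sum_set[symmetric] sum_list_sum_nth atLeast0LessThan)
  have "?M *\<^sub>v v = x \<cdot>\<^sub>v v"
  proof (rule eq_vecI)
    fix i assume "i < dim_vec (x \<cdot>\<^sub>v v)"
    then have i: "i < N" by (simp add: v_def)
    then have "bs ! i \<in> B" using bs(1) by (auto simp: N_def)
    have "Matrix.vec_index (?M *\<^sub>v v) i = (\<Sum>j<N. of_int (c (bs ! i) (bs ! j)) * (bs ! j))"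
      using i by (simp add: M_def v_def scalar_prod_def atLeast0LessThan)
    also have "\<dots> = x * bs ! i"
      using sum_bs[of "\<lambda>b'. of_int (c (bs ! i) b') * b'"] c[OF \<open>bs ! i \<in> B\<close>] by simp
    finally show "Matrix.vec_index (?M *\<^sub>v v) i = Matrix.vec_index (x \<cdot>\<^sub>v v) i"
      using i by (simp add: v_def)
  qed (simp add: M_def v_def)
  moreover have "v \<noteq> 0\<^sub>v N"
  proof
    assume "v = 0\<^sub>v N"
    then have "bs ! i = 0" if "i < N" for i
      using that by (auto simp: v_def vec_eq_iff)
    then show False
      using \<open>1 \<in> B\<close> bs(1) by (metis N_def in_set_conv_nth zero_neq_one)
  qed
  ultimately have "eigenvalue ?M x"
    using v M unfolding eigenvalue_def eigenvector_def by (intro exI[of _ v]) auto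
  then have "poly (char_poly ?M) x = 0"
    using eigenvalue_root_char_poly[of ?M N] M by simp
  then have "poly (map_poly of_int (char_poly M)) x = 0"
    by (simp add: of_int_hom.char_poly_hom[OF M])
  then show ?thesis
    unfolding algebraic_int_altdef_ipoly using degree_monic_char_poly[OF M] by blast
qed

lemma algebraic_int_power_relation:
  fixes x :: complex
  assumes "algebraic_int x"
  obtains d c where "d > 0" "x ^ d = (\<Sum>i<d. of_int (c i) * x ^ i)"
proof -
  obtain f where f: "poly (map_poly of_int f) x = 0" "Polynomial.lead_coeff f = 1"
    using assms unfolding algebraic_int_altdef_ipoly by blast
  have "Polynomial.degree f > 0"
  proof (rule ccontr)
    assume "\<not> Polynomial.degree f > 0"
    then have "f = [:1:]" using f(2) by (metis degree_eq_zeroE gr0I lead_coeff_pCons(2))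
    then show False using f(1) by simp
  qed
  have "0 = (\<Sum>i\<le>Polynomial.degree f. of_int (poly.coeff f i) * x ^ i)"
    using f(1) by (simp add: poly_altdef)
  also have "\<dots> = x ^ Polynomial.degree f + (\<Sum>i<Polynomial.degree f. of_int (poly.coeff f i) * x ^ i)"
    using f(2) by (simp add: lessThan_Suc_atMost[symmetric])
  finally have "x ^ Polynomial.degree f + (\<Sum>i<Polynomial.degree f. of_int (poly.coeff f i) * x ^ i) = 0"
    by simp
  then have "x ^ Polynomial.degree f = (\<Sum>i<Polynomial.degree f. of_int (- poly.coeff f i) * x ^ i)"
    by (simp only: of_int_minus mult_minus_left sum_negf eq_neg_iff_add_eq_0)
  then show thesis
    by (rule that[OF \<open>Polynomial.degree f > 0\<close>])
qed

text \<open>The monomials \<open>x ^ i * y ^ j\<close> below the degrees of the two relations span a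
  module stable under multiplication by \<open>x\<close> and by \<open>y\<close>: an exponent that
  reaches its bound is lowered by the relation.\<close>

lemma algebraic_int_add_times:
  fixes x y :: complex
  assumes "algebraic_int x" "algebraic_int y"
  shows algebraic_int_add: "algebraic_int (x + y)"
    and algebraic_int_times: "algebraic_int (x * y)"
proof -
  obtain d c where d: "d > 0" "x ^ d = (\<Sum>i<d. of_int (c i) * x ^ i)"
    using algebraic_int_power_relation[OF assms(1)] by blast
  obtain e c' where e: "e > 0" "y ^ e = (\<Sum>j<e. of_int (c' j) * y ^ j)"
    using algebraic_int_power_relation[OF assms(2)] by blast
  define B where "B = (\<lambda>(i, j). x ^ i * y ^ j) ` ({..<d} \<times> {..<e})"
  have [simp]: "finite B" by (simp add: B_def)
  have B: "x ^ i * y ^ j \<in> int_span B" if "i < d" "j < e" for i j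
    using that by (intro int_span_base) (auto simp: B_def)
  have "1 \<in> B"
    using d e by (force simp: B_def)
  have X: "x * b \<in> int_span B" if b: "b \<in> B" for b
  proof -
    obtain i j where ij: "b = x ^ i * y ^ j" "i < d" "j < e" using b by (auto simp: B_def)
    show ?thesis
    proof (cases "Suc i = d")
      case True
      have "x * b = x ^ Suc i * y ^ j" by (simp add: ij mult_ac)
      also have "\<dots> = (\<Sum>i<d. of_int (c i) * (x ^ i * y ^ j))"
        unfolding True d(2) sum_distrib_right by (intro sum.cong) (simp_all add: mult_ac)
      also have "\<dots> \<in> int_span B"
        using ij by (intro int_span_sum int_span_scale B) auto
      finally show ?thesis .
    next
      case False
      then show ?thesis using B[of "Suc i" j] ij by (simp add: mult.assoc)
    qed
  qed
  have Y: "y * b \<in> int_span B" if b: "b \<in> B" for b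
  proof -
    obtain i j where ij: "b = x ^ i * y ^ j" "i < d" "j < e" using b by (auto simp: B_def)
    show ?thesis
    proof (cases "Suc j = e")
      case True
      have "y * b = x ^ i * y ^ Suc j" by (simp add: ij mult_ac)
      also have "\<dots> = (\<Sum>j<e. of_int (c' j) * (x ^ i * y ^ j))"
        unfolding True e(2) sum_distrib_left by (intro sum.cong) (simp_all add: mult_ac)
      also have "\<dots> \<in> int_span B"
        using ij by (intro int_span_sum int_span_scale B) auto
      finally show ?thesis .
    next
      case False
      then have "x ^ i * y ^ Suc j \<in> int_span B" using ij by (intro B) simp_all
      then show ?thesis by (simp add: ij(1) mult.left_commute)
    qed
  qed
  show "algebraic_int (x + y)"
    by (rule algebraic_int_if_int_span[of B])
       (use X Y \<open>1 \<in> B\<close> in \<open>auto simp: algebra_simps intro: int_span_add\<close>)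
  have "x * y * b \<in> int_span B" if "b \<in> B" for b
    using int_span_mult[OF X Y[OF that]] by (simp add: mult_ac)
  then show "algebraic_int (x * y)"
    using \<open>1 \<in> B\<close> by (intro algebraic_int_if_int_span[of B]) auto
qed

lemma algebraic_int_diff:
  fixes x y :: complex
  shows "algebraic_int x \<Longrightarrow> algebraic_int y \<Longrightarrow> algebraic_int (x - y)"
  using algebraic_int_add[of x "- y"] by simp

lemma algebraic_int_power:
  fixes x :: complex
  shows "algebraic_int x \<Longrightarrow> algebraic_int (x ^ n)"
  by (induction n) (simp_all add: algebraic_int_times)

lemma algebraic_int_sum:
  fixes f :: "'b \<Rightarrow> complex"
  shows "(\<And>i. i \<in> I \<Longrightarrow> algebraic_int (f i)) \<Longrightarrow> algebraic_int (sum f I)"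
  by (induction I rule: infinite_finite_induct) (simp_all add: algebraic_int_add)

lemma algebraic_int_poly_of_int:
  fixes x :: complex
  assumes "algebraic_int x"
  shows "algebraic_int (poly (map_poly of_int f) x)"
  unfolding poly_altdef
  by (intro algebraic_int_sum algebraic_int_times algebraic_int_power assms)
     (simp add: int_imp_algebraic_int)

lemma algebraic_int_root_of_unity:
  fixes x :: complex
  assumes "x ^ m = 1" "m > 0"
  shows "algebraic_int x"
proof (rule algebraic_int_root[of 1])
  show "algebraic_int (1 :: complex)"
    by simp
  show "poly (Polynomial.monom 1 m) x = 1"
    using assms by (simp add: poly_monom)
  show "\<forall>i. poly.coeff (Polynomial.monom 1 m) i \<in> (\<int> :: complex set)"
    by simp
  show "Polynomial.lead_coeff (Polynomial.monom 1 m) = (1 :: complex)"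
    by (rule Polynomial.lead_coeff_monom)
  show "Polynomial.degree (Polynomial.monom (1 :: complex) m) > 0"
    using assms by (simp add: Polynomial.degree_monom_eq)
qed

section \<open>Integers of cyclotomic fields\<close>

interpretation of_rat_poly_hom: map_poly_idom_hom "of_rat :: rat \<Rightarrow> complex" ..

abbreviation poly_rat :: "rat poly \<Rightarrow> complex \<Rightarrow> complex" where
  "poly_rat f \<equiv> poly (map_poly of_rat f)"

abbreviation poly_int :: "int poly \<Rightarrow> complex \<Rightarrow> complex" where
  "poly_int f \<equiv> poly (map_poly of_int f)"

lemma poly_rat_simps [simp]:
  "poly_rat (f + g) x = poly_rat f x + poly_rat g x"
  "poly_rat (f - g) x = poly_rat f x - poly_rat g x"
  "poly_rat (- f) x = - poly_rat f x"
  "poly_rat (f * g) x = poly_rat f x * poly_rat g x"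
  "poly_rat 1 x = 1"
  "poly_rat (Polynomial.monom c n) x = of_rat c * x ^ n"
  by (simp_all add: of_rat_poly_hom.hom_add of_rat_poly_hom.hom_minus
      of_rat_poly_hom.hom_uminus of_rat_poly_hom.hom_mult of_rat_hom.map_poly_hom_monom poly_monom)

lemma poly_int_eq_poly_rat: "poly_int f x = poly_rat (map_poly of_int f) x"
  by (simp add: map_poly_map_poly o_def)

lemma poly_rat_pcompose: "poly_rat (pcompose f h) x = poly_rat f (poly_rat h x)"
  by (simp add: of_rat_hom.map_poly_pcompose poly_pcompose)

lemma rat_minimal_poly_exists:
  assumes "f \<noteq> 0" "poly_rat f x = 0"
  obtains g where "g \<noteq> 0" "poly_rat g x = 0" "\<And>f. poly_rat f x = 0 \<Longrightarrow> g dvd f"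
proof -
  define n where "n = (LEAST n. \<exists>g. g \<noteq> 0 \<and> poly_rat g x = 0 \<and> Polynomial.degree g = n)"
  have "\<exists>g. g \<noteq> 0 \<and> poly_rat g x = 0 \<and> Polynomial.degree g = n"
    unfolding n_def by (rule LeastI_ex) (use assms in blast)
  then obtain g where g: "g \<noteq> 0" "poly_rat g x = 0" "Polynomial.degree g = n"
    by blast
  have "g dvd f" if f: "poly_rat f x = 0" for f
  proof (rule ccontr)
    assume "\<not> g dvd f"
    then have nz: "f mod g \<noteq> 0" by (simp add: dvd_eq_mod_eq_0)
    have "f = f div g * g + f mod g" by simp
    then have "poly_rat f x = poly_rat (f div g * g + f mod g) x" by simp
    then have "poly_rat (f mod g) x = 0"
      using f g by (simp only: poly_rat_simps) simp
    then have "n \<le> Polynomial.degree (f mod g)"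
      unfolding n_def using nz by (intro Least_le) blast
    then show False
      using degree_mod_less'[OF g(1) nz] g(3) by simp
  qed
  then show thesis
    using that g by blast
qed

text \<open>The gcd \<open>d\<close> of \<open>h\<close> with the minimal polynomial
  \<open>g\<close> does not vanish at \<open>x\<close>. So the cofactor of \<open>d\<close> in
  \<open>g\<close> does, is a multiple of \<open>g\<close>, and thereby makes \<open>d\<close> a
  unit; Bezout then inverts \<open>h\<close> modulo \<open>g\<close>. A vanishing value is covered
  by \<open>inverse 0 = 0\<close>.\<close>

lemma poly_rat_inverse:
  assumes "f0 \<noteq> 0" "poly_rat f0 x = 0"
  obtains k where "inverse (poly_rat h x) = poly_rat k x"
proof (cases "poly_rat h x = 0")
  case True
  then show thesis using that[of 0] by simp
next
  case False
  obtain g where g: "g \<noteq> 0" "poly_rat g x = 0" "\<And>f. poly_rat f x = 0 \<Longrightarrow> g dvd f"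
    using rat_minimal_poly_exists[OF assms] by blast
  define d where "d = gcd h g"
  obtain e where e: "g = d * e" unfolding d_def by (meson dvdE gcd_dvd2)
  obtain h' where h': "h = d * h'" unfolding d_def by (meson dvdE gcd_dvd1)
  have "poly_rat d x * poly_rat h' x \<noteq> 0"
    using False by (simp add: h')
  then have "poly_rat e x = 0"
    using g(2) by (simp add: e)
  then obtain k where "e = g * k"
    using g(3) by (meson dvdE)
  then have "g * (d * k) = g * 1" using e by (simp add: mult_ac)
  then have "d * k = 1" using g(1) by (metis mult_cancel_left)
  obtain a b where "a * h + b * g = d"
    by (rule that[OF bezout_coefficients_fst_snd[of h g, folded d_def]])
  moreover have "h * (a * k) = (a * h + b * g) * k - g * (b * k)"
    by (simp add: algebra_simps)
  ultimately have "h * (a * k) = 1 - g * (b * k)"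
    by (simp only: \<open>d * k = 1\<close>)
  then have "poly_rat (h * (a * k)) x = 1"
    using g(2) by (simp only: poly_rat_simps) simp
  then have "poly_rat h x * poly_rat (a * k) x = 1"
    by (simp only: poly_rat_simps)
  then show thesis
    using that[of "a * k"] inverse_unique by blast
qed

text \<open>Orthogonality of the characters of a cyclic group; \<open>m - i\<close> stands for
  \<open>- i\<close> to keep the exponents natural.\<close>

lemma sum_powers_root_of_unity:
  fixes z :: complex
  assumes z: "z ^ m = 1" "\<And>j. 0 < j \<Longrightarrow> j < m \<Longrightarrow> z ^ j \<noteq> 1" and "l < m" "i < m"
  shows "(\<Sum>j<m. (z ^ (l + (m - i))) ^ j) = (if l = i then of_nat m else 0)"
proof (cases "l = i")
  case True
  then show ?thesis using z \<open>i < m\<close> by simp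
next
  case False
  let ?w = "z ^ (l + (m - i))"
  have "?w \<noteq> 1"
  proof (cases "l + (m - i) < m")
    case True
    then show ?thesis using \<open>i < m\<close> by (intro z(2)) auto
  next
    case ge: False
    then have "l + (m - i) = m + (l - i)" using \<open>i < m\<close> by simp
    then have "?w = z ^ (l - i)"
      using z(1) by (simp add: power_add)
    moreover have "z ^ (l - i) \<noteq> 1"
      using False ge \<open>l < m\<close> by (intro z(2)) auto
    ultimately show ?thesis by simp
  qed
  moreover have "?w ^ m = 1"
    using z(1) by (simp add: power_mult[symmetric] mult.commute[of _ m]) (simp add: power_mult)
  ultimately show ?thesis
    using False geometric_sum[of ?w m] by simp
qed

text \<open>
  A rational polynomial \<open>h\<close> representing \<open>\<alpha>\<close> at the root of unity \<open>z\<close> can be chosen to vanish at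
  all \<open>m\<close>-th roots of unity not conjugate to \<open>z\<close>. Then all its values at \<open>m\<close>-th roots of unity are
  algebraic integers, and Fourier inversion bounds the denominators of its coefficients by \<open>m\<close>.
\<close>
lemma cyclotomic_integer_denominator:
  assumes z: "z ^ m = 1" "\<And>j. 0 < j \<Longrightarrow> j < m \<Longrightarrow> z ^ j \<noteq> 1" and "m > 0"
    and \<alpha>: "\<alpha> = poly_rat h0 z" "algebraic_int \<alpha>"
  obtains H where "of_nat m * \<alpha> = poly_int H z"
proof -
  define P :: "rat poly" where "P = Polynomial.monom 1 m - 1"
  have P: "poly_rat P s = s ^ m - 1" for s
    unfolding P_def by (simp only: poly_rat_simps of_rat_1 mult_1_left)
  have deg_P: "Polynomial.degree P = m"
    unfolding P_def using \<open>m > 0\<close>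
    using Polynomial.degree_add_eq_left[of "- 1" "Polynomial.monom (1 :: rat) m"]
    by (simp add: Polynomial.degree_monom_eq)
  have "P \<noteq> 0"
    using deg_P \<open>m > 0\<close> by auto
  obtain g where g: "g \<noteq> 0" "poly_rat g z = 0" "\<And>f. poly_rat f z = 0 \<Longrightarrow> g dvd f"
    using rat_minimal_poly_exists[OF \<open>P \<noteq> 0\<close>, of z] P z(1) by auto
  have "g dvd P"
    using P z(1) by (intro g(3)) simp
  then obtain u where u: "P = g * u" by (elim dvdE)
  have "Rings.coprime g u"
  proof (rule coprimeI)
    fix d assume "d dvd g" "d dvd u"
    then have "d dvd pderiv P" "d dvd P"
      by (auto simp: u pderiv_mult)
    \<comment> \<open>For \<open>P = X ^ m - 1\<close> the combination of \<open>X\<close> times the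
      derivative minus \<open>m * P\<close> is the nonzero constant \<open>m\<close>, so
      \<open>P\<close> has no repeated factor.\<close>
    then have "d dvd [:0, 1:] * pderiv P - Polynomial.smult (of_nat m) P"
      by (intro dvd_diff dvd_mult dvd_smult)
    moreover have "[:0, 1:] * pderiv P = Polynomial.smult (of_nat m) (Polynomial.monom 1 m)"
      using \<open>m > 0\<close>
      by (simp add: P_def pderiv_diff pderiv_monom smult_monom monom_Suc[symmetric])
    then have "[:0, 1:] * pderiv P - Polynomial.smult (of_nat m) P = [:of_nat m:]"
      by (simp add: P_def smult_diff_right)
    ultimately have "d dvd [:of_nat m:]" by simp
    moreover have "[:of_nat m:] dvd (1 :: rat poly)"
      using \<open>m > 0\<close> by (simp add: is_unit_const_poly_iff)
    ultimately show "d dvd 1" by (rule dvd_trans)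
  qed
  then have gcd: "gcd g u = 1"
    by (rule coprime_imp_gcd_eq_1)
  obtain a b where ab: "a * g + b * u = 1"
    by (rule that[OF bezout_coefficients_fst_snd[of g u, unfolded gcd]])
  \<comment> \<open>\<open>b * u\<close> is 1 at the roots of \<open>g\<close> and 0 at the roots of
    \<open>u\<close>.\<close>
  define h1 where "h1 = h0 * (b * u)"
  have "poly_rat (a * g + b * u) z = 1"
    by (simp only: ab poly_rat_simps)
  then have h1z: "poly_rat h1 z = \<alpha>"
    using g(2) by (simp add: h1_def \<alpha>)
  obtain F where F: "poly_int F \<alpha> = 0" "Polynomial.lead_coeff F = 1"
    using \<alpha>(2) unfolding algebraic_int_altdef_ipoly by blast
  have h1_int: "algebraic_int (poly_rat h1 s)" if s: "s ^ m = 1" for s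
  proof (cases "poly_rat u s = 0")
    case True
    then show ?thesis by (simp add: h1_def)
  next
    case False
    have "poly_rat g s * poly_rat u s = 0"
      using P[of s] s by (simp add: u)
    then have gs: "poly_rat g s = 0"
      using False by simp
    \<comment> \<open>Integrality passes from \<open>z\<close> to its conjugate \<open>s\<close>:
      the composition of \<open>F\<close> with \<open>h1\<close> is a rational polynomial vanishing
      at \<open>z\<close>, hence a multiple of \<open>g\<close>, hence zero at
      \<open>s\<close>.\<close>
    have "poly_rat (pcompose (map_poly of_int F) h1) z = 0"
      using F(1) by (simp only: poly_rat_pcompose h1z poly_int_eq_poly_rat)
    from g(3)[OF this] obtain k where "pcompose (map_poly of_int F) h1 = g * k"
      by (elim dvdE)
    then have "poly_rat (pcompose (map_poly of_int F) h1) s = 0"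
      using gs by simp
    then have "poly_int F (poly_rat h1 s) = 0"
      by (simp only: poly_rat_pcompose poly_int_eq_poly_rat)
    then show ?thesis
      unfolding algebraic_int_altdef_ipoly using F(2) by blast
  qed
  \<comment> \<open>Reduction modulo \<open>X ^ m - 1\<close> keeps the values at all
    \<open>m\<close>-th roots of unity and leaves only \<open>m\<close> coefficients, which these
    values determine.\<close>
  define h where "h = h1 mod P"
  have h: "poly_rat h s = poly_rat h1 s" if "s ^ m = 1" for s
  proof -
    have "poly_rat h1 s = poly_rat (h1 div P * P + h1 mod P) s" by simp
    also have "\<dots> = poly_rat h s"
      using P[of s] that by (simp only: poly_rat_simps h_def) simp
    finally show ?thesis by simp
  qed
  have "Polynomial.degree h < m"
    using degree_mod_less[OF \<open>P \<noteq> 0\<close>, of h1] deg_P \<open>m > 0\<close> by (auto simp: h_def)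
  then have sum_h: "poly_rat h s = (\<Sum>i<m. of_rat (poly.coeff h i) * s ^ i)" for s
  proof -
    have "poly_rat h s = (\<Sum>i\<le>Polynomial.degree h. of_rat (poly.coeff h i) * s ^ i)"
      by (simp add: poly_altdef)
    also have "\<dots> = (\<Sum>i<m. of_rat (poly.coeff h i) * s ^ i)"
      using \<open>Polynomial.degree h < m\<close>
      by (intro sum.mono_neutral_left) (auto intro: Polynomial.coeff_eq_0)
    finally show ?thesis .
  qed
  define c :: "nat \<Rightarrow> complex" where "c i = of_nat m * of_rat (poly.coeff h i)" for i
  have c_int: "c i \<in> \<int>" if "i < m" for i
  proof (rule rational_algebraic_int_is_int)
    show "c i \<in> \<rat>" by (simp add: c_def)
    have pw: "(z ^ k) ^ m = 1" for k
    proof -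
      have "(z ^ k) ^ m = (z ^ m) ^ k"
        by (simp add: power_mult[symmetric] mult.commute[of k m])
      then show ?thesis using z(1) by simp
    qed
    have "(\<Sum>j<m. poly_rat h (z ^ j) * z ^ ((m - i) * j)) =
        (\<Sum>j<m. \<Sum>l<m. of_rat (poly.coeff h l) * (z ^ (l + (m - i))) ^ j)"
      unfolding sum_h sum_distrib_right
      by (intro sum.cong refl)
         (simp add: power_mult[symmetric] power_add[symmetric] mult.assoc distrib_right distrib_left
           mult.commute[of _ "_ :: nat"])
    also have "\<dots> = (\<Sum>l<m. of_rat (poly.coeff h l) * (\<Sum>j<m. (z ^ (l + (m - i))) ^ j))"
      by (subst sum.swap) (simp add: sum_distrib_left)
    also have "\<dots> = (\<Sum>l<m. if l = i then c i else 0)"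
      by (intro sum.cong)
         (use sum_powers_root_of_unity[OF z _ that] in \<open>auto simp: c_def\<close>)
    also have "\<dots> = c i" using that by simp
    finally have "c i = (\<Sum>j<m. poly_rat h (z ^ j) * z ^ ((m - i) * j))" by simp
    also have "algebraic_int \<dots>"
      by (intro algebraic_int_sum algebraic_int_times)
         (use \<open>m > 0\<close> in \<open>auto simp: h pw intro!: h1_int algebraic_int_root_of_unity[of _ m]\<close>)
    finally show "algebraic_int (c i)" .
  qed
  \<comment> \<open>The floor of the real part turns the complex number \<open>c i\<close> into a
    coefficient of type \<open>int\<close>.\<close>
  have floor_c: "of_int \<lfloor>Re (c i)\<rfloor> = c i" if "i < m" for i
    using c_int[OF that] by (elim Ints_cases) simp
  define H where "H = (\<Sum>i<m. Polynomial.monom \<lfloor>Re (c i)\<rfloor> i)"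
  have "\<alpha> = (\<Sum>i<m. of_rat (poly.coeff h i) * z ^ i)"
    using h[OF z(1)] h1z sum_h[of z] by simp
  then have "of_nat m * \<alpha> = (\<Sum>i<m. c i * z ^ i)"
    by (simp only: c_def mult.assoc sum_distrib_left[symmetric])
  also have "\<dots> = (\<Sum>i<m. of_int \<lfloor>Re (c i)\<rfloor> * z ^ i)"
    using floor_c by simp
  also have "\<dots> = poly_int H z"
    by (simp add: H_def of_int_poly_hom.hom_sum poly_sum of_int_hom.map_poly_hom_monom poly_monom)
  finally show thesis by (rule that)
qed

section \<open>Elements of Q(\<theta>) as rational polynomials in a root of unity\<close>

lemma complex_ring_simps [simp]:
  "carrier complex_ring = UNIV" "mult complex_ring = (*)" "one complex_ring = 1"
  "ring.zero complex_ring = 0" "add complex_ring = (+)"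
  by (simp_all add: ring_of_type_algebra_def)

lemma cring_complex_ring: "cring complex_ring"
  by (rule cring_from_type_algebra)

lemma a_inv_complex_ring [simp]: "\<ominus>\<^bsub>complex_ring\<^esub> x = - x"
proof -
  interpret cring complex_ring
    by (rule cring_complex_ring)
  show ?thesis
    by (rule minus_equality) simp_all
qed

lemma m_inv_complex_ring: "x \<noteq> 0 \<Longrightarrow> inv\<^bsub>complex_ring\<^esub> x = inverse x"
proof -
  interpret cring complex_ring
    by (rule cring_complex_ring)
  show "x \<noteq> 0 \<Longrightarrow> ?thesis"
    by (rule comm_inv_char) simp_all
qed

text \<open>Elements are expressed in \<open>z\<close> rather than in \<open>\<theta>\<close>
  because the bound on denominators concerns roots of unity. Reality is carried along because it
  makes complex conjugation fix the field.\<close>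

lemma rat_adjoin_subset:
  assumes f0: "f0 \<noteq> 0" "poly_rat f0 z = 0" and \<theta>: "\<theta> = poly_rat t z" "\<theta> \<in> \<real>"
    and x: "x \<in> rat_adjoin \<theta>"
  shows rat_adjoin_subset_poly_rat: "\<exists>h. x = poly_rat h z" and rat_adjoin_subset_Reals: "x \<in> \<real>"
proof -
  have "(\<exists>h. x = poly_rat h z) \<and> x \<in> \<real>"
    using x unfolding rat_adjoin_def
  proof (induction rule: generate_field.induct)
    case one
    show ?case by (auto intro!: exI[of _ 1])
  next
    case (incl x)
    moreover have "\<exists>h. x = poly_rat h z" if rat: "x \<in> \<rat>"
    proof -
      obtain r where "x = of_rat r" using Rats_cases[OF rat] by blast
      then have "x = poly_rat (Polynomial.monom r 0) z"
        by (simp only: poly_rat_simps power_0 mult_1_right)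
      then show ?thesis ..
    qed
    moreover have "x \<in> \<real>" if "x \<in> \<rat>"
      using that by (elim Rats_cases') simp
    ultimately show ?case using \<theta> by auto
  next
    case (a_inv x)
    then obtain h where "x = poly_rat h z" by blast
    then show ?case using a_inv by (auto intro!: exI[of _ "- h"])
  next
    case (m_inv x)
    then obtain h where h: "x = poly_rat h z" by blast
    obtain k where k: "inverse x = poly_rat k z"
      unfolding h by (rule poly_rat_inverse[OF f0])
    have "inverse x \<in> \<real>" using m_inv by simp
    moreover have "inv\<^bsub>complex_ring\<^esub> x = inverse x"
      using m_inv by (intro m_inv_complex_ring) simp
    ultimately show ?case using k by auto
  next
    case (eng_add x y)
    then obtain h h' where "x = poly_rat h z" "y = poly_rat h' z" by blast
    then show ?case using eng_add by (auto intro!: exI[of _ "h + h'"])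
  next
    case (eng_mult x y)
    then obtain h h' where "x = poly_rat h z" "y = poly_rat h' z" by blast
    then show ?case using eng_mult by (auto intro!: exI[of _ "h * h'"])
  qed
  then show "\<exists>h. x = poly_rat h z" "x \<in> \<real>" by blast+
qed

section \<open>Frobenius congruences\<close>

text \<open>Congruence modulo \<open>p\<close> among all algebraic integers, so that no integral
  basis of a particular field is required. For \<open>p > 0\<close> the quotient \<open>w\<close>
  lies in every field containing \<open>u\<close> and \<open>v\<close>.\<close>

definition alg_cong :: "nat \<Rightarrow> complex \<Rightarrow> complex \<Rightarrow> bool" where
  "alg_cong p u v \<longleftrightarrow> (\<exists>w. algebraic_int w \<and> u = v + of_nat p * w)"

lemma alg_cong_refl: "alg_cong p u u"
  unfolding alg_cong_def by (intro exI[of _ 0]) simp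

lemma alg_cong_sym: "alg_cong p u v \<Longrightarrow> alg_cong p v u"
  unfolding alg_cong_def by (elim exE conjE, rule_tac x = "- w" in exI) simp

lemma alg_cong_add:
  assumes "alg_cong p u v" "alg_cong p u' v'"
  shows "alg_cong p (u + u') (v + v')"
proof -
  obtain w w' where "algebraic_int w" "u = v + of_nat p * w" "algebraic_int w'" "u' = v' + of_nat p * w'"
    using assms by (auto simp: alg_cong_def)
  then show ?thesis
    unfolding alg_cong_def
    by (intro exI[of _ "w + w'"]) (simp add: algebraic_int_add algebra_simps)
qed

lemma alg_cong_trans:
  assumes "alg_cong p u v" "alg_cong p v s"
  shows "alg_cong p u s"
proof -
  obtain w w' where "algebraic_int w" "u = v + of_nat p * w" "algebraic_int w'" "v = s + of_nat p * w'"
    using assms by (auto simp: alg_cong_def)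
  then show ?thesis
    unfolding alg_cong_def
    by (intro exI[of _ "w + w'"]) (simp add: algebraic_int_add algebra_simps)
qed

lemma alg_cong_mult_left:
  assumes "alg_cong p u v" "algebraic_int s"
  shows "alg_cong p (s * u) (s * v)"
proof -
  obtain w where "algebraic_int w" "u = v + of_nat p * w"
    using assms by (auto simp: alg_cong_def)
  then show ?thesis
    unfolding alg_cong_def using assms(2)
    by (intro exI[of _ "s * w"]) (simp add: algebraic_int_times algebra_simps)
qed

lemma alg_cong_mult:
  assumes "alg_cong p u v" "alg_cong p u' v'" "algebraic_int u" "algebraic_int v'"
  shows "alg_cong p (u * u') (v * v')"
  using alg_cong_trans[OF alg_cong_mult_left[OF assms(2,3)]] alg_cong_mult_left[OF assms(1,4)]
  by (simp add: mult.commute)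

lemma alg_cong_algebraic_int: "alg_cong p u v \<Longrightarrow> algebraic_int v \<Longrightarrow> algebraic_int u"
  unfolding alg_cong_def by (auto intro!: algebraic_int_add algebraic_int_times)

lemma alg_cong_power:
  assumes "alg_cong p u v" "algebraic_int v"
  shows "alg_cong p (u ^ k) (v ^ k)"
proof (induction k)
  case (Suc k)
  show ?case
    unfolding power_Suc
    by (rule alg_cong_mult) (use Suc assms alg_cong_algebraic_int in \<open>auto intro: algebraic_int_power\<close>)
qed (simp add: alg_cong_refl)

text \<open>The middle binomial terms divided by \<open>p\<close>. They are kept explicit because,
  as an integer polynomial in \<open>u\<close> and \<open>v\<close>, this quotient stays in Z[z]
  whenever \<open>u\<close> and \<open>v\<close> do.\<close>

definition freshman_rest :: "nat \<Rightarrow> complex \<Rightarrow> complex \<Rightarrow> complex" where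
  "freshman_rest p u v = (\<Sum>k\<in>{1..<p}. of_nat ((p choose k) div p) * (u ^ k * v ^ (p - k)))"

lemma freshman_rest:
  assumes "Factorial_Ring.prime p"
  shows "(u + v) ^ p = u ^ p + v ^ p + of_nat p * freshman_rest p u v"
proof -
  have "p > 0" using assms by (rule prime_gt_0_nat)
  have "(u + v) ^ p = (\<Sum>k\<in>{..p}. of_nat (p choose k) * u ^ k * v ^ (p - k))"
    by (rule binomial_ring)
  also have "{..p} = insert 0 (insert p {1..<p})"
    using \<open>p > 0\<close> by auto
  also have "(\<Sum>k\<in>insert 0 (insert p {1..<p}). of_nat (p choose k) * u ^ k * v ^ (p - k)) =
      v ^ p + (u ^ p + (\<Sum>k\<in>{1..<p}. of_nat (p choose k) * u ^ k * v ^ (p - k)))"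
    using \<open>p > 0\<close> by (subst sum.insert; simp)+
  also have "(\<Sum>k\<in>{1..<p}. of_nat (p choose k) * u ^ k * v ^ (p - k)) = of_nat p * freshman_rest p u v"
    unfolding freshman_rest_def sum_distrib_left
  proof (rule sum.cong[OF refl])
    fix k assume "k \<in> {1..<p}"
    then have "p dvd (p choose k)"
      using assms \<open>p > 0\<close> by (intro dvd_choose_prime) auto
    then have "of_nat (p choose k) = (of_nat p * of_nat ((p choose k) div p) :: complex)"
      by (metis dvd_mult_div_cancel of_nat_mult)
    then show "of_nat (p choose k) * u ^ k * v ^ (p - k) =
        of_nat p * (of_nat ((p choose k) div p) * (u ^ k * v ^ (p - k)))"
      by simp
  qed
  finally show ?thesis by simp
qed

lemma alg_cong_freshman:
  assumes "Factorial_Ring.prime p" "algebraic_int u" "algebraic_int v"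
  shows "alg_cong p ((u + v) ^ p) (u ^ p + v ^ p)"
  unfolding alg_cong_def freshman_rest[OF assms(1)]
  unfolding freshman_rest_def
  by (intro exI[of _ "\<Sum>k\<in>{1..<p}. of_nat ((p choose k) div p) * (u ^ k * v ^ (p - k))"]
        conjI refl algebraic_int_sum algebraic_int_times algebraic_int_power assms)
     (simp add: int_imp_algebraic_int)

lemma alg_cong_uminus_power:
  assumes "Factorial_Ring.prime p" "algebraic_int u"
  shows "alg_cong p ((- u) ^ p) (- (u ^ p))"
proof (cases "p = 2")
  case True
  then show ?thesis
    unfolding alg_cong_def using assms(2)
    by (intro exI[of _ "u ^ 2"]) (simp add: algebraic_int_power)
next
  case False
  then have "odd p"
    using assms(1) primes_dvd_imp_eq two_is_prime_nat by blast
  then show ?thesis by (simp add: alg_cong_refl)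
qed

lemma alg_cong_of_int_prime_power:
  assumes "Factorial_Ring.prime p"
  shows "alg_cong p (of_int a ^ p) (of_int a)"
proof -
  have nat: "alg_cong p (of_nat k ^ p) (of_nat k)" for k
  proof (induction k)
    case 0
    then show ?case using prime_gt_0_nat[OF assms] by (simp add: zero_power alg_cong_refl)
  next
    case (Suc k)
    have "alg_cong p ((of_nat k + 1) ^ p) (of_nat k ^ p + 1 ^ p)"
      by (rule alg_cong_freshman[OF assms]) (simp_all add: int_imp_algebraic_int)
    moreover have "alg_cong p (of_nat k ^ p + 1 ^ p) (of_nat k + 1)"
      using alg_cong_add[OF Suc alg_cong_refl, of 1] by simp
    ultimately show ?case
      using alg_cong_trans by (simp add: add.commute)
  qed
  show ?thesis
  proof (cases "a \<ge> 0")
    case True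
    then obtain k where "a = int k" using nonneg_int_cases by blast
    then show ?thesis using nat by simp
  next
    case False
    then obtain k where k: "a = - int k" using int_cases4[of a] by force
    have "alg_cong p ((- of_nat k) ^ p) (- (of_nat k ^ p))"
      by (rule alg_cong_uminus_power[OF assms]) (simp add: int_imp_algebraic_int)
    moreover have "alg_cong p (- (of_nat k ^ p)) (- of_nat k)"
      using alg_cong_mult_left[OF nat, of "- 1" k] by simp
    ultimately show ?thesis
      using alg_cong_trans by (simp add: k)
  qed
qed

lemma alg_cong_of_int_prime_power_power:
  assumes "Factorial_Ring.prime p"
  shows "alg_cong p (of_int a ^ p ^ n) (of_int a)"
proof (induction n)
  case (Suc n)
  have "alg_cong p ((of_int a ^ p ^ n) ^ p) (of_int a ^ p)"
    by (rule alg_cong_power[OF Suc]) (simp add: int_imp_algebraic_int)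
  then show ?case
    using alg_cong_trans[OF _ alg_cong_of_int_prime_power[OF assms]]
    by (simp add: power_mult[symmetric] mult.commute)
qed (simp add: alg_cong_refl)

lemma poly_int_pCons: "poly_int (pCons a H) x = of_int a + x * poly_int H x"
  by (simp add: of_int_hom.map_poly_pCons_hom)

lemma alg_cong_poly_int_prime_power:
  assumes "Factorial_Ring.prime p" "algebraic_int x"
  shows "alg_cong p (poly_int H x ^ p) (poly_int H (x ^ p))"
proof (induction H rule: pCons_induct)
  case 0
  then show ?case using prime_gt_0_nat[OF assms(1)] by (simp add: zero_power alg_cong_refl)
next
  case (pCons a H)
  have int: "algebraic_int (x * poly_int H x)"
    by (intro algebraic_int_times algebraic_int_poly_of_int assms)
  have "alg_cong p ((of_int a + x * poly_int H x) ^ p) (of_int a ^ p + (x * poly_int H x) ^ p)"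
    using int by (intro alg_cong_freshman assms) (simp_all add: int_imp_algebraic_int)
  moreover have "alg_cong p (of_int a ^ p + (x * poly_int H x) ^ p) (of_int a + x ^ p * poly_int H (x ^ p))"
    unfolding power_mult_distrib
    by (intro alg_cong_add alg_cong_of_int_prime_power alg_cong_mult_left pCons
        algebraic_int_power assms)
  ultimately show ?case
    unfolding poly_int_pCons by (rule alg_cong_trans)
qed

lemma alg_cong_poly_int_prime_power_power:
  assumes "Factorial_Ring.prime p" "algebraic_int x"
  shows "alg_cong p (poly_int H x ^ p ^ n) (poly_int H (x ^ p ^ n))"
proof (induction n)
  case (Suc n)
  have "alg_cong p ((poly_int H x ^ p ^ n) ^ p) (poly_int H (x ^ p ^ n) ^ p)"
    by (intro alg_cong_power Suc algebraic_int_poly_of_int algebraic_int_power assms)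
  moreover have "alg_cong p (poly_int H (x ^ p ^ n) ^ p) (poly_int H ((x ^ p ^ n) ^ p))"
    by (intro alg_cong_poly_int_prime_power algebraic_int_power assms)
  ultimately have "alg_cong p ((poly_int H x ^ p ^ n) ^ p) (poly_int H ((x ^ p ^ n) ^ p))"
    by (rule alg_cong_trans)
  then show ?case
    by (simp add: power_mult[symmetric] mult.commute)
qed (simp add: alg_cong_refl)

text \<open>Bezout for \<open>m\<close> and \<open>p\<close> writes \<open>u - v\<close> as a
  multiple of \<open>m * u - m * v\<close> plus \<open>p\<close> times an algebraic integer. This
  removes the denominator \<open>m\<close> left by Fourier inversion.\<close>

lemma alg_cong_cancel:
  assumes "Rings.coprime m p" "alg_cong p (of_nat m * u) (of_nat m * v)"
    and "algebraic_int u" "algebraic_int v"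
  shows "alg_cong p u v"
proof -
  obtain w where w: "algebraic_int w" "of_nat m * u = of_nat m * v + of_nat p * w"
    using assms(2) by (auto simp: alg_cong_def)
  have "Rings.coprime (int m) (int p)"
    using assms(1) by (simp only: coprime_int_iff)
  then have gcd: "gcd (int m) (int p) = 1"
    by (rule coprime_imp_gcd_eq_1)
  obtain a b where "a * int m + b * int p = gcd (int m) (int p)"
    using bezout_int by blast
  then have "of_int (a * int m + b * int p) = (1 :: complex)"
    by (simp only: gcd of_int_1)
  then have ab: "of_int a * of_nat m + of_int b * of_nat p = (1 :: complex)"
    by simp
  have "u - v = (of_int a * of_nat m + of_int b * of_nat p) * (u - v)"
    by (simp only: ab mult_1_left)
  also have "\<dots> = of_int a * (of_nat m * u - of_nat m * v) + of_nat p * (of_int b * (u - v))"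
    by (simp add: algebra_simps)
  also have "\<dots> = of_nat p * (of_int a * w + of_int b * (u - v))"
    unfolding w(2) by (simp add: algebra_simps)
  finally have "u = v + of_nat p * (of_int a * w + of_int b * (u - v))"
    by (simp add: algebra_simps)
  moreover have "algebraic_int (of_int a * w + of_int b * (u - v))"
    using w(1) assms(3,4)
    by (intro algebraic_int_add algebraic_int_times algebraic_int_diff)
       (simp_all add: int_imp_algebraic_int)
  ultimately show ?thesis
    unfolding alg_cong_def by blast
qed

text \<open>Modulo \<open>p\<close>, the \<open>p ^ n\<close>-th power of
  \<open>H(z) = m * \<alpha>\<close> is \<open>H(z ^ p ^ n)\<close>, where \<open>z ^ p ^ n\<close>
  is \<open>z\<close> or its conjugate. As \<open>\<alpha>\<close> is real and \<open>H\<close> has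
  integer coefficients, both give \<open>m * \<alpha>\<close>. Since \<open>m ^ p ^ n\<close> is
  congruent to \<open>m\<close> and \<open>p\<close> does not divide \<open>m\<close>, the factor
  \<open>m\<close> cancels.\<close>

lemma alg_cong_frobenius_unramified:
  assumes "Factorial_Ring.prime p" "n > 0"
    and z: "z ^ m = 1" "\<And>j. 0 < j \<Longrightarrow> j < m \<Longrightarrow> z ^ j \<noteq> 1" and "m > 0"
    and m: "m dvd p ^ n - 1 \<or> m dvd p ^ n + 1"
    and cnj: "cnj z = inverse z"
    and \<alpha>: "\<alpha> = poly_rat h0 z" "\<alpha> \<in> \<real>" "algebraic_int \<alpha>"
  shows "alg_cong p (\<alpha> ^ p ^ n) \<alpha>"
proof -
  have int_z: "algebraic_int z"
    using z(1) \<open>m > 0\<close> by (rule algebraic_int_root_of_unity)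
  obtain H where H: "of_nat m * \<alpha> = poly_int H z"
    by (rule cyclotomic_integer_denominator[OF z \<open>m > 0\<close> \<alpha>(1,3)])
  have "p ^ n > 0" using prime_gt_0_nat[OF assms(1)] by simp
  have "z ^ p ^ n = z \<or> z ^ p ^ n = cnj z"
    using m
  proof
    assume "m dvd p ^ n - 1"
    then obtain k where "p ^ n = Suc (m * k)"
      using \<open>p ^ n > 0\<close> by (metis dvdE Suc_diff_1)
    then show ?thesis using z(1) by (simp add: power_mult)
  next
    assume "m dvd p ^ n + 1"
    then obtain k where "Suc (p ^ n) = m * k" by (auto elim: dvdE)
    then have "z * z ^ p ^ n = 1"
      using z(1) by (simp add: power_Suc[symmetric] power_mult del: power_Suc)
    then show ?thesis
      using inverse_unique cnj by metis
  qed
  then have "poly_int H (z ^ p ^ n) = of_nat m * \<alpha>"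
  proof
    assume "z ^ p ^ n = cnj z"
    then have "poly_int H (z ^ p ^ n) = cnj (poly_int H z)"
      by (simp add: poly_altdef)
    also have "\<dots> = of_nat m * \<alpha>"
      using \<alpha>(2) by (simp add: H[symmetric] Reals_cnj_iff)
    finally show ?thesis .
  qed (simp add: H)
  then have "alg_cong p ((of_nat m * \<alpha>) ^ p ^ n) (of_nat m * \<alpha>)"
    using alg_cong_poly_int_prime_power_power[OF assms(1) int_z, of H n] by (simp add: H)
  moreover have "alg_cong p (of_nat m * \<alpha> ^ p ^ n) ((of_nat m * \<alpha>) ^ p ^ n)"
  proof -
    have "alg_cong p (\<alpha> ^ p ^ n * of_nat m) (\<alpha> ^ p ^ n * of_nat m ^ p ^ n)"
      using alg_cong_of_int_prime_power_power[OF assms(1), of "int m" n]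
      by (intro alg_cong_mult_left algebraic_int_power \<alpha>) (simp add: alg_cong_sym)
    then show ?thesis by (simp add: power_mult_distrib mult.commute)
  qed
  ultimately have "alg_cong p (of_nat m * \<alpha> ^ p ^ n) (of_nat m * \<alpha>)"
    using alg_cong_trans by blast
  moreover have "Rings.coprime m p"
  proof -
    have "\<not> p dvd m"
    proof
      assume "p dvd m"
      then have "p dvd p ^ n - 1 \<or> p dvd p ^ n + 1" using m dvd_trans by blast
      moreover have "p dvd p ^ n" using \<open>n > 0\<close> by simp
      ultimately have "p dvd 1"
        using \<open>p ^ n > 0\<close> by (metis dvd_add_right_iff dvd_diffD1 Suc_leI One_nat_def)
      then show False using prime_gt_1_nat[OF assms(1)] by simp
    qed
    then show ?thesis
      using prime_imp_coprime[OF assms(1)] by (simp add: ac_simps)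
  qed
  ultimately show ?thesis
    using alg_cong_cancel[of m p "\<alpha> ^ p ^ n" \<alpha>] \<alpha>(3) by (simp add: algebraic_int_power)
qed

section \<open>The ring Z[z] and the ramified case\<close>

definition poly_int_ring :: "complex \<Rightarrow> complex set" where
  "poly_int_ring z = range (\<lambda>H. poly_int H z)"

lemma poly_int_ring_closed:
  "u \<in> poly_int_ring z \<Longrightarrow> v \<in> poly_int_ring z \<Longrightarrow> u + v \<in> poly_int_ring z"
  "u \<in> poly_int_ring z \<Longrightarrow> v \<in> poly_int_ring z \<Longrightarrow> u * v \<in> poly_int_ring z"
  "of_int a \<in> poly_int_ring z" "z \<in> poly_int_ring z"
proof -
  show "u \<in> poly_int_ring z \<Longrightarrow> v \<in> poly_int_ring z \<Longrightarrow> u + v \<in> poly_int_ring z"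
    by (auto simp: poly_int_ring_def of_int_poly_hom.hom_add[symmetric] poly_add[symmetric] simp del: poly_add)
  show "u \<in> poly_int_ring z \<Longrightarrow> v \<in> poly_int_ring z \<Longrightarrow> u * v \<in> poly_int_ring z"
    by (auto simp: poly_int_ring_def of_int_poly_hom.hom_mult[symmetric] poly_mult[symmetric] simp del: poly_mult)
  show "of_int a \<in> poly_int_ring z"
    unfolding poly_int_ring_def by (rule range_eqI[of _ _ "[:a:]"])
        (simp only: poly_int_pCons of_int_poly_hom.hom_zero poly_0 mult_zero_right add_0_right)
  show "z \<in> poly_int_ring z"
    unfolding poly_int_ring_def by (rule range_eqI[of _ _ "[:0, 1:]"]) simp
qed

lemma poly_int_ring_power: "u \<in> poly_int_ring z \<Longrightarrow> u ^ k \<in> poly_int_ring z"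
  using poly_int_ring_closed(3)[of 1 z] by (induction k) (auto intro: poly_int_ring_closed)

lemma poly_int_ring_sum:
  "(\<And>i. i \<in> I \<Longrightarrow> f i \<in> poly_int_ring z) \<Longrightarrow> sum f I \<in> poly_int_ring z"
  using poly_int_ring_closed(3)[of 0 z]
  by (induction I rule: infinite_finite_induct) (auto intro: poly_int_ring_closed)

lemma poly_int_ring_algebraic_int:
  "algebraic_int z \<Longrightarrow> u \<in> poly_int_ring z \<Longrightarrow> algebraic_int u"
  by (auto simp: poly_int_ring_def algebraic_int_poly_of_int)

text \<open>Modulo \<open>1 - z\<close> the element \<open>z\<close> becomes 1, so
  \<open>H(z)\<close> reduces to the integer \<open>H(1)\<close>; the factor theorem over the
  integers supplies the quotient.\<close>

lemma poly_int_ring_residue: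
  assumes "u \<in> poly_int_ring z"
  obtains a v where "u = of_int a + (1 - z) * v" "v \<in> poly_int_ring z"
proof -
  obtain H where H: "u = poly_int H z" using assms by (auto simp: poly_int_ring_def)
  have "poly (H - [:poly H 1:]) 1 = 0" by simp
  then have "[:- 1, 1:] dvd H - [:poly H 1:]"
    by (simp only: poly_eq_0_iff_dvd)
  then obtain K where "H - [:poly H 1:] = [:-1, 1:] * K"
    by (rule dvdE)
  then have "H = [:poly H 1:] + [:-1, 1:] * K"
    by (simp add: diff_eq_eq add.commute)
  then have "u = poly_int ([:poly H 1:] + [:-1, 1:] * K) z"
    using H by simp
  also have "\<dots> = of_int (poly H 1) + (1 - z) * (of_int (- 1) * poly_int K z)"
    unfolding of_int_poly_hom.hom_add of_int_poly_hom.hom_mult poly_add poly_mult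
      poly_int_pCons of_int_poly_hom.hom_zero poly_0
    by (simp add: algebra_simps)
  finally show thesis
    by (rule that) (intro poly_int_ring_closed, simp add: poly_int_ring_def)
qed

lemma sum_powers_root_of_unity_eq_0:
  fixes z :: complex
  assumes "z ^ m = 1" "z \<noteq> 1"
  shows "(\<Sum>j<m. z ^ j) = 0"
  using assms by (simp add: geometric_sum)

text \<open>
  With \<open>\<pi> = 1 - z\<close> we have \<open>\<pi> ^ p = p \<gamma>\<close> and \<open>p = \<pi> \<kappa>\<close> in the ring generated by \<open>z\<close>, whose residue
  ring modulo \<open>\<pi>\<close> is generated by the integers. Hence an element of this ring that is divisible by
  \<open>\<pi>\<close> among the algebraic integers is divisible by \<open>\<pi>\<close> within the ring, so that the ring is
  integrally closed.
\<close>
lemma alg_cong_frobenius_ramified: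
  assumes p: "Factorial_Ring.prime p" "odd p"
    and z: "z ^ p = 1" "\<And>j. 0 < j \<Longrightarrow> j < p \<Longrightarrow> z ^ j \<noteq> 1"
    and \<alpha>: "\<alpha> = poly_rat h0 z" "algebraic_int \<alpha>"
  obtains a where "alg_cong p (\<alpha> ^ p) (of_int a)"
proof -
  have "p > 0" using p(1) by (rule prime_gt_0_nat)
  let ?R = "poly_int_ring z"
  have int_z: "algebraic_int z"
    using z(1) \<open>p > 0\<close> by (rule algebraic_int_root_of_unity)
  note int_R = poly_int_ring_algebraic_int[OF int_z]
  define \<pi> where "\<pi> = 1 - z"
  have "z \<noteq> 1" using z(2)[of 1] prime_gt_1_nat[OF p(1)] by simp
  then have "\<pi> \<noteq> 0" by (simp add: \<pi>_def)
  have [simp]: "1 \<in> ?R" "of_nat k \<in> ?R" "of_int a \<in> ?R" "- 1 \<in> ?R" for k a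
    using poly_int_ring_closed(3)[of 1 z] poly_int_ring_closed(3)[of "int k" z]
      poly_int_ring_closed(3)[of "- 1" z] by (simp_all add: poly_int_ring_closed(3))
  have neg_z: "- z \<in> ?R"
    using poly_int_ring_closed(2)[of "- 1" z z] poly_int_ring_closed(4) by simp
  then have \<pi>_R: "\<pi> \<in> ?R"
    using poly_int_ring_closed(1)[of 1 z "- z"] by (simp add: \<pi>_def)
  define \<gamma> where "\<gamma> = freshman_rest p 1 (- z)"
  \<comment> \<open>The outer terms 1 and \<open>(- z) ^ p = - 1\<close> of the binomial expansion
    cancel because \<open>p\<close> is odd.\<close>
  have \<gamma>: "\<pi> ^ p = of_nat p * \<gamma>"
    using freshman_rest[OF p(1), of 1 "- z"] p(2) z(1) by (simp add: \<pi>_def \<gamma>_def)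
  have \<gamma>_R: "\<gamma> \<in> ?R"
    unfolding \<gamma>_def freshman_rest_def
    by (intro poly_int_ring_sum poly_int_ring_closed poly_int_ring_power neg_z) simp_all
  define \<kappa> where "\<kappa> = (\<Sum>j<p. \<Sum>i<j. z ^ i)"
  have \<kappa>_R: "\<kappa> \<in> ?R"
    unfolding \<kappa>_def by (intro poly_int_ring_sum poly_int_ring_power poly_int_ring_closed)
  \<comment> \<open>The powers of \<open>z\<close> sum to 0, and each \<open>1 - z ^ j\<close> is
    \<open>1 - z\<close> times a geometric sum.\<close>
  have "of_nat p = (\<Sum>j<p. 1 - z ^ j)"
    using sum_powers_root_of_unity_eq_0[OF z(1) \<open>z \<noteq> 1\<close>] by (simp add: sum_subtractf)
  also have "\<dots> = \<pi> * \<kappa>"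
    unfolding \<kappa>_def sum_distrib_left \<pi>_def
    by (intro sum.cong refl) (simp add: one_diff_power_eq sum_distrib_left)
  finally have \<kappa>: "of_nat p = \<pi> * \<kappa>" .
  have int_div: "\<exists>a'. a = int p * a'" if "algebraic_int (of_int a / \<pi>)" for a :: int
  proof -
    \<comment> \<open>The factor \<open>\<gamma>\<close> turns the denominator
      \<open>\<pi> ^ p\<close> into \<open>p\<close>. The result is rational and an algebraic
      integer, hence an integer.\<close>
    have "(of_int a / \<pi>) ^ p * \<gamma> = of_int (a ^ p) / of_nat p"
      using \<gamma> \<open>\<pi> \<noteq> 0\<close> \<open>p > 0\<close> by (cases "\<gamma> = 0") (simp_all add: power_divide field_simps)
    moreover have "algebraic_int ((of_int a / \<pi>) ^ p * \<gamma>)"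
      by (intro algebraic_int_times algebraic_int_power that int_R \<gamma>_R)
    ultimately have "algebraic_int (of_int (a ^ p) / of_nat p :: complex)"
      by simp
    then have "(of_int (a ^ p) / of_nat p :: complex) \<in> \<int>"
      by (rule rational_algebraic_int_is_int) auto
    then obtain b where "(of_int (a ^ p) / of_nat p :: complex) = of_int b"
      by (elim Ints_cases)
    then have "(of_int (a ^ p) :: complex) = of_int (b * int p)"
      using \<open>p > 0\<close> by (simp add: field_simps)
    then have "a ^ p = b * int p"
      by (simp only: of_int_eq_iff)
    then have "int p dvd a ^ p" by simp
    moreover have "Factorial_Ring.prime (int p)" using p(1) by simp
    ultimately have "int p dvd a"
      by (rule Factorial_Ring.prime_dvd_power[rotated])
    then show ?thesis by (rule dvdE) (rule exI)
  qed
  have R_div: "v \<in> ?R" if v: "algebraic_int v" "\<pi> * v \<in> ?R" for v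
  proof -
    obtain a w where w: "\<pi> * v = of_int a + \<pi> * w" "w \<in> ?R"
      by (rule poly_int_ring_residue[OF v(2), folded \<pi>_def])
    \<comment> \<open>Subtracting \<open>w\<close> shows that \<open>a / \<pi>\<close> is integral;
      then \<open>p = \<pi> * \<kappa>\<close> divides \<open>a\<close>, and \<open>\<pi>\<close>
      can be cancelled inside the ring.\<close>
    have "of_int a = (v - w) * \<pi>"
      using w(1) by (simp add: algebra_simps)
    then have "of_int a / \<pi> = v - w"
      using \<open>\<pi> \<noteq> 0\<close> by simp
    then have "algebraic_int (of_int a / \<pi>)"
      using v(1) w(2) int_R by (simp add: algebraic_int_diff)
    then obtain a' where "a = int p * a'" using int_div by blast
    then have "\<pi> * v = \<pi> * (\<kappa> * of_int a' + w)"
      using w(1) \<kappa> by (simp add: algebra_simps)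
    then have "v = \<kappa> * of_int a' + w" using \<open>\<pi> \<noteq> 0\<close> by simp
    then show ?thesis
      using w(2) \<kappa>_R by (simp add: poly_int_ring_closed)
  qed
  obtain H where H: "of_nat p * \<alpha> = poly_int H z"
    by (rule cyclotomic_integer_denominator[OF z \<open>p > 0\<close> \<alpha>])
  \<comment> \<open>Multiplied by \<open>\<gamma>\<close>, the denominator \<open>p\<close> of
    \<open>\<alpha>\<close> becomes \<open>p\<close> factors \<open>\<pi>\<close>, which
    \<open>R_div\<close> removes one at a time.\<close>
  have "\<pi> ^ p * \<alpha> = \<gamma> * poly_int H z"
    unfolding \<gamma> H[symmetric] by simp
  moreover have "poly_int H z \<in> ?R" by (simp add: poly_int_ring_def)
  ultimately have start: "\<pi> ^ p * \<alpha> \<in> ?R"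
    using \<gamma>_R by (simp add: poly_int_ring_closed)
  have "\<pi> ^ k * \<alpha> \<in> ?R \<Longrightarrow> \<alpha> \<in> ?R" for k
  proof (induction k)
    case (Suc k)
    have "\<pi> ^ k * \<alpha> \<in> ?R"
    proof (rule R_div)
      show "algebraic_int (\<pi> ^ k * \<alpha>)"
        by (intro algebraic_int_times algebraic_int_power int_R[OF \<pi>_R] \<alpha>(2))
      show "\<pi> * (\<pi> ^ k * \<alpha>) \<in> ?R"
        using Suc.prems by (simp add: mult.assoc)
    qed
    then show ?case by (rule Suc.IH)
  qed simp
  from this[OF start] obtain a w where w: "\<alpha> = of_int a + \<pi> * w" "w \<in> ?R"
    by (rule poly_int_ring_residue[of \<alpha> z, folded \<pi>_def])
  \<comment> \<open>The \<open>p\<close>-th power turns a congruence modulo \<open>\<pi>\<close>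
    into one modulo \<open>p\<close>, since \<open>p\<close> divides
    \<open>\<pi> ^ p\<close>.\<close>
  have "alg_cong p ((of_int a + \<pi> * w) ^ p) (of_int a ^ p + (\<pi> * w) ^ p)"
    by (intro alg_cong_freshman p algebraic_int_times int_R w \<pi>_R) (simp add: int_imp_algebraic_int)
  moreover have "alg_cong p (of_int a ^ p + (\<pi> * w) ^ p) (of_int a + 0)"
  proof (rule alg_cong_add[OF alg_cong_of_int_prime_power[OF p(1)]])
    show "alg_cong p ((\<pi> * w) ^ p) 0"
      unfolding alg_cong_def power_mult_distrib \<gamma>
      by (intro exI[of _ "\<gamma> * w ^ p"] conjI algebraic_int_times algebraic_int_power int_R \<gamma>_R w) simp
  qed
  ultimately have "alg_cong p (\<alpha> ^ p) (of_int a)"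
    using alg_cong_trans by (simp add: w(1))
  then show thesis by (rule that)
qed

text \<open>The power on the left accounts for the ramification at \<open>p\<close> in the case \<open>m = p\<close>.\<close>
lemma alg_cong_frobenius:
  assumes p: "Factorial_Ring.prime p" "odd p" "n > 0"
    and z: "z ^ m = 1" "\<And>j. 0 < j \<Longrightarrow> j < m \<Longrightarrow> z ^ j \<noteq> 1" and "m > 0"
    and m: "m dvd p ^ n - 1 \<or> m dvd p ^ n + 1 \<or> m = p"
    and cnj: "cnj z = inverse z"
    and \<alpha>: "\<alpha> = poly_rat h0 z" "\<alpha> \<in> \<real>" "algebraic_int \<alpha>"
  shows "alg_cong p ((\<alpha> ^ p ^ n - \<alpha>) ^ p) 0"
proof -
  have int: "algebraic_int (\<alpha> ^ k)" for k
    by (intro algebraic_int_power \<alpha>)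
  have "alg_cong p ((\<alpha> ^ p ^ n) ^ p) (\<alpha> ^ p)"
  proof (cases "m = p")
    case False
    then have "alg_cong p (\<alpha> ^ p ^ n) \<alpha>"
      using m by (intro alg_cong_frobenius_unramified[OF p(1,3) z \<open>m > 0\<close> _ cnj \<alpha>]) auto
    then show ?thesis by (intro alg_cong_power \<alpha>)
  next
    case True
    \<comment> \<open>Modulo \<open>p\<close>, the power \<open>\<alpha> ^ p\<close> is an integer,
      and integers are fixed by \<open>p ^ n\<close>-th powers.\<close>
    then obtain a where a: "alg_cong p (\<alpha> ^ p) (of_int a)"
      using alg_cong_frobenius_ramified[OF p(1,2) _ _ \<alpha>(1,3)] z by blast
    then have "alg_cong p ((\<alpha> ^ p) ^ p ^ n) (of_int a ^ p ^ n)"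
      by (intro alg_cong_power) (simp_all add: int_imp_algebraic_int)
    then have "alg_cong p ((\<alpha> ^ p) ^ p ^ n) (of_int a)"
      using alg_cong_of_int_prime_power_power[OF p(1)] by (rule alg_cong_trans)
    then have "alg_cong p ((\<alpha> ^ p) ^ p ^ n) (\<alpha> ^ p)"
      using alg_cong_sym[OF a] by (rule alg_cong_trans)
    then show ?thesis by (simp add: power_mult[symmetric] mult.commute)
  qed
  then have "alg_cong p ((\<alpha> ^ p ^ n) ^ p + (- \<alpha>) ^ p) (\<alpha> ^ p + (- \<alpha>) ^ p)"
    by (intro alg_cong_add alg_cong_refl)
  moreover have "alg_cong p ((\<alpha> ^ p ^ n + - \<alpha>) ^ p) ((\<alpha> ^ p ^ n) ^ p + (- \<alpha>) ^ p)"
    using \<alpha>(3) int by (intro alg_cong_freshman p) simp_all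
  ultimately have "alg_cong p ((\<alpha> ^ p ^ n + - \<alpha>) ^ p) (\<alpha> ^ p + (- \<alpha>) ^ p)"
    using alg_cong_trans by blast
  then show ?thesis using p(2) by simp
qed

section \<open>Finite domains\<close>

lemma (in ring) eval_replicate_zero_append:
  assumes "b \<in> carrier R" "x \<in> carrier R"
  shows "eval (replicate k \<zero> @ [b]) x = b"
  using assms by (induction k) simp_all

lemma (in domain) finite_if_pow_eq_self:
  assumes "d \<ge> 1" "\<And>x. x \<in> carrier R \<Longrightarrow> x \<noteq> \<zero> \<Longrightarrow> x [^] (d :: nat) = \<one>"
  shows "finite (carrier R)"
proof -
  \<comment> \<open>The coefficient list of \<open>X ^ d - 1\<close>, leading coefficient
    first.\<close>
  define f where "f = \<one> # (replicate (d - 1) \<zero> @ [\<ominus> \<one>])"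
  have "f \<in> carrier (poly_ring R)"
    by (auto simp: f_def univ_poly_carrier[symmetric] Polynomials.polynomial_def)
  then have "finite {x. is_root f x}"
    by (rule finite_number_of_roots)
  moreover have "carrier R \<subseteq> insert \<zero> {x. is_root f x}"
  proof
    fix x assume x: "x \<in> carrier R"
    have "eval f x = \<one> \<otimes> x [^] d \<oplus> \<ominus> \<one>"
      using x \<open>d \<ge> 1\<close> by (simp add: f_def eval_replicate_zero_append)
    then have "eval f x = \<zero>" if "x \<noteq> \<zero>"
      using assms(2)[OF x that] by (simp add: r_neg)
    then show "x \<in> insert \<zero> {x. is_root f x}"
      using x by (auto simp: is_root_def f_def)
  qed
  ultimately show ?thesis
    using finite_subset by blast
qed

text \<open>Extending \<open>E'\<close> by a vector outside it is a direct sum, so each step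
  multiplies the cardinality by that of \<open>K\<close>.\<close>

lemma (in ring) card_dimension:
  assumes K: "subfield K R" "finite K"
  shows "dimension n K E \<Longrightarrow> finite E \<and> card E = card K ^ n"
proof (induction n arbitrary: E)
  case 0
  have "E = {\<zero>}" using K(1) 0 by (rule dimension_zero)
  then show ?case by simp
next
  case (Suc n)
  obtain v E' where v: "v \<in> carrier R" "v \<notin> E'" "dimension n K E'" "E = line_extension K v E'"
    using Suc.prems by (cases rule: dimension.cases) auto
  have IH: "finite E'" "card E' = card K ^ n" using Suc.IH[OF v(3)] by auto
  note E' = space_subgroup_props[OF K(1) v(3)]
  have Kc: "K \<subseteq> carrier R" using K(1) by (rule subfieldE(3))
  have E: "E = (\<lambda>(k, e). k \<otimes> v \<oplus> e) ` (K \<times> E')"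
    unfolding v(4) by (auto simp: line_extension_mem_iff) blast
  have "inj_on (\<lambda>(k, e). k \<otimes> v \<oplus> e) (K \<times> E')"
  proof (rule inj_onI, clarsimp)
    fix k e k' e'
    assume a: "k \<in> K" "e \<in> E'" "k' \<in> K" "e' \<in> E'" "k \<otimes> v \<oplus> e = k' \<otimes> v \<oplus> e'"
    have c: "k \<in> carrier R" "k' \<in> carrier R" "e \<in> carrier R" "e' \<in> carrier R"
      using a Kc E'(1) by auto
    have "(k \<ominus> k') \<otimes> v = (k \<otimes> v \<oplus> e) \<ominus> e \<ominus> k' \<otimes> v"
      using c v(1) by algebra
    also have "\<dots> = e' \<ominus> e"
      unfolding a(5) using c v(1) by algebra
    also have "\<dots> \<in> E'"
      using a E' by (simp add: a_minus_def)
    finally have "(k \<ominus> k') \<otimes> v \<in> E'" .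
    moreover have kk: "k \<ominus> k' \<in> K"
      using a K(1) by (simp add: a_minus_def subring.axioms subringE(5,7) subfieldE(1))
    ultimately have "k \<ominus> k' = \<zero>"
      using E'(6)[of "k \<ominus> k'" v] v(1,2) by blast
    then have "k = k'" using c by simp
    then have "e = e'" using a(5) c v(1) by simp
    then show "k = k' \<and> e = e'" using \<open>k = k'\<close> by simp
  qed
  then have "card E = card (K \<times> E')"
    unfolding E by (rule card_image)
  then show ?case
    using IH K(2) unfolding E by (simp add: card_cartesian_product)
qed

lemma (in domain) pow_minus_one_eq_one:
  assumes "x \<in> carrier R" "x \<noteq> \<zero>" "k \<ge> 1" "x [^] (k :: nat) = x"
  shows "x [^] (k - 1) = \<one>"
proof -
  have "x [^] Suc (k - 1) = x" using assms(3,4) by simp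
  then have "x \<otimes> x [^] (k - 1) = x \<otimes> \<one>"
    using assms(1) unfolding nat_pow_Suc2[OF assms(1)] by simp
  then show ?thesis
    by (rule iffD1[OF m_lcancel, rotated 4]) (use assms in simp_all)
qed

lemma (in domain) card_le_if_pow_eq_self:
  assumes "finite (carrier R)" "k \<ge> 2" "\<And>x. x \<in> carrier R \<Longrightarrow> x [^] k = x"
  shows "card (carrier R) \<le> k"
proof -
  have "carrier R - {\<zero>} \<subseteq> {x \<in> carrier R. x [^] (k - 1) = \<one>}"
  proof
    fix x assume x: "x \<in> carrier R - {\<zero>}"
    then show "x \<in> {x \<in> carrier R. x [^] (k - 1) = \<one>}"
      using pow_minus_one_eq_one[of x k] assms(2,3) by simp
  qed
  then have "card (carrier R - {\<zero>}) \<le> card {x \<in> carrier R. x [^] (k - 1) = \<one>}"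
    using assms(1) by (intro card_mono) simp_all
  also have "\<dots> \<le> k - 1"
    using assms(2) by (intro num_roots_le_deg[OF assms(1)]) simp
  finally have "card (carrier R - {\<zero>}) \<le> k - 1" .
  then show ?thesis using assms(1,2) by simp
qed

lemma (in field) pow_card_eq_self:
  assumes "finite (carrier R)" "x \<in> carrier R"
  shows "x [^] card (carrier R) = x"
proof (cases "x = \<zero>")
  case True
  have "card (carrier R) \<noteq> 0" using assms by auto
  then show ?thesis by (simp add: True nat_pow_zero)
next
  case False
  interpret G: group "Multiplicative_Group.mult_of R"
    by (rule field_mult_group)
  have "x \<in> carrier (Multiplicative_Group.mult_of R)" using assms(2) False by simp
  moreover have "finite (carrier (Multiplicative_Group.mult_of R))" using assms(1) by (rule finite_mult_of)
  ultimately have "x [^]\<^bsub>Multiplicative_Group.mult_of R\<^esub> order (Multiplicative_Group.mult_of R) = \<one>\<^bsub>Multiplicative_Group.mult_of R\<^esub>"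
    by (intro G.pow_order_eq_1)
  then have "x [^] (card (carrier R) - 1) = \<one>"
    using assms(1) by (simp add: Multiplicative_Group.nat_pow_mult_of order_def)
  moreover have "card (carrier R) > 0" using assms by (auto simp: card_gt_0_iff)
  ultimately show ?thesis
    using nat_pow_Suc2[OF assms(2), of "card (carrier R) - 1"] assms(2) by simp
qed

text \<open>The nonzero elements are roots of \<open>X ^ (p ^ n - 1) - 1\<close>, so the domain is
  finite and a field with \<open>p ^ d\<close> elements. For \<open>r = n mod d\<close> all elements
  then satisfy \<open>x ^ p ^ r = x\<close> too, which for \<open>0 < r < d\<close> is too many
  roots. The map \<open>h\<close> is the canonical map from the integers.\<close>

lemma (in domain) dim_prime_subfield_dvd:
  fixes h :: "int \<Rightarrow> 'a"
  assumes p: "Factorial_Ring.prime p" and "n > 0"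
    and h: "h 1 = \<one>" "h (int p) = \<zero>" "\<And>a. h a \<in> carrier R"
      "\<And>a b. h (a + b) = h a \<oplus> h b" "\<And>a b. h (a * b) = h a \<otimes> h b"
    and frob: "\<And>x. x \<in> carrier R \<Longrightarrow> x [^] (p ^ n) = x"
  shows "dim (generate_field R {}) (carrier R) dvd n"
proof -
  have "p \<ge> 2" using p by (rule prime_ge_2_nat)
  then have "p ^ n \<ge> 2" using \<open>n > 0\<close> by (meson le_trans self_le_power one_le_numeral)
  have pow1: "x [^] (p ^ n - 1) = \<one>" if "x \<in> carrier R" "x \<noteq> \<zero>" for x
    using that frob \<open>p ^ n \<ge> 2\<close> by (intro pow_minus_one_eq_one) auto
  have fin: "finite (carrier R)"
    by (rule finite_if_pow_eq_self[OF _ pow1]) (use \<open>p ^ n \<ge> 2\<close> in auto)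
  \<comment> \<open>The power \<open>p ^ n - 2\<close> is the inverse. It makes \<open>R\<close> a
    field, and it keeps inverses inside the image of \<open>h\<close>.\<close>
  have pow2: "x \<otimes> x [^] (p ^ n - 2) = \<one>" if "x \<in> carrier R" "x \<noteq> \<zero>" for x
    using pow1[OF that] nat_pow_Suc2[of x "p ^ n - 2"] \<open>p ^ n \<ge> 2\<close> that
    by (simp add: numeral_2_eq_2 Suc_diff_Suc)
  have "field R"
  proof (rule cring_fieldI)
    show "Units R = carrier R - {\<zero>}"
    proof
      show "Units R \<subseteq> carrier R - {\<zero>}"
        using Units_closed by (auto simp: Units_def)
      show "carrier R - {\<zero>} \<subseteq> Units R"
        using pow2 m_comm by (auto simp: Units_def intro!: bexI[of _ "_ [^] (p ^ n - 2)"])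
    qed
  qed
  then interpret field R .
  define K where "K = generate_field R {}"
  have subfield_K: "subfield K R"
    unfolding K_def by (rule generate_field_is_subfield) simp
  have h0: "h 0 = \<zero>"
    using h(4)[of 0 0] h(3)[of 0] by simp
  have h_neg: "h (- a) = \<ominus> h a" for a
    using h(4)[of "- a" a] h0 h(3) by (simp add: minus_equality)
  have h_pow: "h (a ^ k) = h a [^] k" for a and k :: nat
    by (induction k) (simp_all add: h(1,5) h(3) mult.commute m_comm)
  have "K \<subseteq> range h"
    unfolding K_def
  proof (rule generate_field_min_subfield1)
    show "subfield (range h) R"
    proof (rule subfieldI')
      show "subring (range h) R"
        using h(3) range_eqI[of \<one> h 1] h(1)
        by (intro subringI) (auto simp: h_neg[symmetric] h(4,5)[symmetric])
      fix k assume k: "k \<in> range h - {\<zero>}"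
      then have "inv k = k [^] (p ^ n - 2)"
        using pow2 h(3) by (intro comm_inv_char) auto
      then show "inv k \<in> range h"
        using k by (auto simp: h_pow[symmetric])
    qed
  qed simp_all
  moreover have "range h \<subseteq> K"
  proof -
    have nat: "h (int i) \<in> K" for i
      unfolding K_def
    proof (induction i)
      case 0
      then show ?case by (simp add: h0 zero_in_generate)
    next
      case (Suc i)
      then show ?case
        using h(4)[of "int i" 1] by (auto simp: h(1) add.commute intro: generate_field.intros)
    qed
    show ?thesis
    proof
      fix x assume "x \<in> range h"
      then obtain a where a: "x = h a" by blast
      show "x \<in> K"
      proof (cases "a \<ge> 0")
        case True
        then show ?thesis using nat[of "nat a"] by (simp add: a)
      next
        case False
        then have "x = \<ominus> h (int (nat (- a)))" by (simp add: a h_neg[symmetric])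
        then show ?thesis
          using nat[of "nat (- a)"] unfolding K_def by (auto intro: generate_field.intros)
      qed
    qed
  qed
  ultimately have K: "K = range h" by blast
  have h_dvd: "h a = \<zero> \<longleftrightarrow> int p dvd a" for a
  proof
    assume "int p dvd a"
    then show "h a = \<zero>" using h(2,3) by (auto simp: h(5) elim: dvdE)
  next
    assume "h a = \<zero>"
    show "int p dvd a"
    proof (rule ccontr)
      assume "\<not> int p dvd a"
      moreover have "Factorial_Ring.prime (int p)" using p by simp
      ultimately have "Rings.coprime (int p) a" by (intro prime_imp_coprime)
      then obtain u v where "u * int p + v * a = 1"
        using bezout_int[of "int p" a] by (auto simp: coprime_iff_gcd_eq_1)
      then have "h (u * int p + v * a) = \<one>" by (simp add: h(1))
      then have "\<zero> = \<one>" using h(3) by (simp add: h(4,5) h(2) \<open>h a = \<zero>\<close>)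
      then show False by simp
    qed
  qed
  have h_eq: "h a = h b \<longleftrightarrow> int p dvd a - b" for a b
  proof -
    have "h (a - b) = h a \<ominus> h b"
      using h(4)[of a "- b"] by (simp add: h_neg a_minus_def)
    then show ?thesis using h_dvd[of "a - b"] h(3) by simp
  qed
  have "card K = p"
  proof -
    have "K = h ` {0..<int p}"
    proof -
      have "h a = h (a mod int p)" for a
        by (simp add: h_eq minus_mod_eq_mult_div)
      then have "h a \<in> h ` {0..<int p}" for a
        using \<open>p \<ge> 2\<close> by (intro image_eqI[of _ _ "a mod int p"]) auto
      then show ?thesis unfolding K by auto
    qed
    moreover have "inj_on h {0..<int p}"
    proof (rule inj_onI)
      fix a b assume "a \<in> {0..<int p}" "b \<in> {0..<int p}" "h a = h b"
      then show "a = b"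
        using h_eq[of a b] zdvd_imp_le[of "int p" "a - b"] zdvd_imp_le[of "int p" "b - a"]
        by (cases a b rule: linorder_cases) (auto simp: dvd_diff_commute)
    qed
    ultimately show ?thesis by (simp add: card_image)
  qed
  have finK: "finite K"
    using fin subfieldE(3)[OF subfield_K] finite_subset by blast
  have "finite_dimension K (carrier R)"
  proof -
    obtain Us where Us: "set Us = carrier R" using fin finite_list by blast
    then have "Span K Us = carrier R"
      using Span_subgroup_props(1)[OF subfield_K, of Us] Span_base_incl[OF subfield_K, of Us] by auto
    then show ?thesis using Span_finite_dimension[OF subfield_K, of Us] Us by simp
  qed
  then have "dimension (dim K (carrier R)) K (carrier R)"
    using finite_dimensionE[OF subfield_K] by (simp add: over_def)
  then have card: "card (carrier R) = p ^ dim K (carrier R)"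
    using card_dimension[OF subfield_K finK] \<open>card K = p\<close> by blast
  define d where "d = dim K (carrier R)"
  have "d > 0"
  proof (rule ccontr)
    assume "\<not> d > 0"
    then have "card (carrier R) = 1" using card by (simp add: d_def)
    then show False using card_mono[OF fin, of "{\<zero>, \<one>}"] by simp
  qed
  have pow_d: "x [^] (p ^ (d * c)) = x" if "x \<in> carrier R" for x c
  proof (induction c)
    case (Suc c)
    have "x [^] (p ^ (d * Suc c)) = (x [^] (p ^ (d * c))) [^] (p ^ d)"
      using that by (simp add: nat_pow_pow power_add[symmetric] add.commute)
    then show ?case
      using Suc pow_card_eq_self[OF fin that] card by (simp add: d_def)
  qed (use that in simp)
  have "n mod d = 0"
  proof (rule ccontr)
    assume "n mod d \<noteq> 0"
    have "x [^] (p ^ (n mod d)) = x" if x: "x \<in> carrier R" for x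
    proof -
      have "x = x [^] (p ^ (d * (n div d) + n mod d))"
        using frob[OF x] by simp
      also have "\<dots> = (x [^] (p ^ (d * (n div d)))) [^] (p ^ (n mod d))"
        using x by (simp only: nat_pow_pow power_add)
      also have "\<dots> = x [^] (p ^ (n mod d))" by (simp add: pow_d[OF x])
      finally show ?thesis by simp
    qed
    moreover have "p ^ (n mod d) \<ge> 2"
      using \<open>p \<ge> 2\<close> \<open>n mod d \<noteq> 0\<close> by (meson le_trans self_le_power one_le_numeral neq0_conv)
    ultimately have "p ^ d \<le> p ^ (n mod d)"
      using card_le_if_pow_eq_self[OF fin] card by (simp add: d_def)
    then have "d \<le> n mod d"
      using \<open>p \<ge> 2\<close> by (simp add: power_increasing_iff)
    then show False using mod_less_divisor[OF \<open>d > 0\<close>, of n] by linarith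
  qed
  then show ?thesis
    unfolding d_def K_def by (rule mod_0_imp_dvd)
qed

section \<open>Inertia degrees\<close>

text \<open>Zorn's lemma for the ideals that contain \<open>a\<close> and omit 1, a condition
  inherited by unions of nonempty chains; a maximal ideal is prime.\<close>

lemma (in cring) nonunit_in_prime_ideal:
  assumes a: "a \<in> carrier R" "a \<notin> Units R"
  obtains P where "primeideal P R" "a \<in> P"
proof -
  define S where "S = {I. ideal I R \<and> a \<in> I \<and> \<one> \<notin> I}"
  have "\<one> \<notin> PIdl a"
  proof
    assume "\<one> \<in> PIdl a"
    then obtain x where "x \<in> carrier R" "\<one> = x \<otimes> a" by (auto simp: cgenideal_def)
    then show False using a m_comm by (auto simp: Units_def)
  qed
  then have "PIdl a \<in> S"
    using a by (simp add: S_def cgenideal_ideal cgenideal_self)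
  then have "S \<noteq> {}" by blast
  have "\<exists>M\<in>S. \<forall>J\<in>S. M \<subseteq> J \<longrightarrow> J = M"
  proof (rule subset_Zorn_nonempty[OF \<open>S \<noteq> {}\<close>])
    fix C assume C: "C \<noteq> {}" "subset.chain S C"
    then have "C \<subseteq> S" by (simp add: subset_chain_def)
    have "subset.chain {I. ideal I R} C"
      using C(2) by (auto simp: subset_chain_def S_def)
    from chain_Union_is_ideal[OF this] have "ideal (\<Union>C) R"
      using C(1) by simp
    then show "\<Union>C \<in> S"
      using C(1) \<open>C \<subseteq> S\<close> by (auto simp: S_def)
  qed
  then obtain M where M: "M \<in> S" "\<And>J. J \<in> S \<Longrightarrow> M \<subseteq> J \<Longrightarrow> J = M" by blast
  have "maximalideal M R"
  proof (rule maximalidealI)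
    show "ideal M R" "carrier R \<noteq> M" using M(1) by (auto simp: S_def)
    fix J assume J: "ideal J R" "M \<subseteq> J" "J \<subseteq> carrier R"
    show "J = M \<or> J = carrier R"
    proof (cases "\<one> \<in> J")
      case True
      then show ?thesis using ideal.one_imp_carrier[OF J(1)] by blast
    next
      case False
      then show ?thesis using M J by (auto simp: S_def)
    qed
  qed
  then have "primeideal M R" by (rule maximalideal_prime)
  moreover have "a \<in> M" using M(1) by (simp add: S_def)
  ultimately show thesis by (rule that)
qed

lemma integer_ring_simps [simp]:
  "carrier (integer_ring E) = {x \<in> E. algebraic_int x}"
  "mult (integer_ring E) = (*)" "one (integer_ring E) = 1"
  "ring.zero (integer_ring E) = 0" "add (integer_ring E) = (+)"
  by (simp_all add: integer_ring_def)

lemma Rats_subset_rat_adjoin: "x \<in> \<rat> \<Longrightarrow> x \<in> rat_adjoin \<theta>"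
  unfolding rat_adjoin_def by (rule generate_field.incl) simp

lemma rat_adjoin_uminus: "x \<in> rat_adjoin \<theta> \<Longrightarrow> - x \<in> rat_adjoin \<theta>"
  unfolding rat_adjoin_def using generate_field.a_inv[of x complex_ring] by simp

lemma rat_adjoin_add: "x \<in> rat_adjoin \<theta> \<Longrightarrow> y \<in> rat_adjoin \<theta> \<Longrightarrow> x + y \<in> rat_adjoin \<theta>"
  unfolding rat_adjoin_def using generate_field.eng_add[of x complex_ring _ y] by simp

lemma rat_adjoin_mult: "x \<in> rat_adjoin \<theta> \<Longrightarrow> y \<in> rat_adjoin \<theta> \<Longrightarrow> x * y \<in> rat_adjoin \<theta>"
  unfolding rat_adjoin_def using generate_field.eng_mult[of x complex_ring _ y] by simp

lemma rat_adjoin_power: "x \<in> rat_adjoin \<theta> \<Longrightarrow> x ^ k \<in> rat_adjoin \<theta>"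
  by (induction k) (simp_all add: rat_adjoin_mult Rats_subset_rat_adjoin)

lemma cring_integer_ring: "cring (integer_ring (rat_adjoin \<theta>))"
proof -
  interpret C: cring complex_ring by (rule cring_complex_ring)
  have "subring {x \<in> rat_adjoin \<theta>. algebraic_int x} complex_ring"
    by (rule C.subringI)
       (auto simp: rat_adjoin_add rat_adjoin_mult rat_adjoin_uminus Rats_subset_rat_adjoin
         algebraic_int_add algebraic_int_times)
  then have "subcring {x \<in> rat_adjoin \<theta>. algebraic_int x} complex_ring"
    by (rule C.subcringI')
  then show ?thesis
    unfolding integer_ring_def using C.subcring_iff by simp
qed

text \<open>\<open>1 / p\<close> is rational but not an integer, so it is no algebraic integer and
  \<open>p\<close> is a nonunit. Hence the choice in \<open>inertia_degree\<close> returns a genuine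
  prime.\<close>

lemma prime_above_exists:
  assumes "Factorial_Ring.prime p"
  shows "\<exists>P. prime_above p (rat_adjoin \<theta>) P"
proof -
  interpret O: cring "integer_ring (rat_adjoin \<theta>)" by (rule cring_integer_ring)
  have "of_nat p \<notin> Units (integer_ring (rat_adjoin \<theta>))"
  proof
    assume "of_nat p \<in> Units (integer_ring (rat_adjoin \<theta>))"
    then obtain y where y: "algebraic_int y" "of_nat p * y = (1 :: complex)"
      by (auto simp: Units_def)
    then have y_eq: "y = inverse (of_nat p)" by (simp add: inverse_unique)
    then have "y \<in> \<rat>" by simp
    then have "y \<in> \<int>" using y(1) by (intro rational_algebraic_int_is_int)
    then obtain b where "y = of_int b" by (rule Ints_cases)
    then have "of_int (int p * b) = (1 :: complex)" using y(2) by simp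
    then have "int p * b = 1" by (simp only: of_int_eq_1_iff)
    then have "int p dvd 1" by (metis dvd_triv_left)
    then show False using prime_gt_1_nat[OF assms] by simp
  qed
  moreover have "of_nat p \<in> carrier (integer_ring (rat_adjoin \<theta>))"
    by (simp add: Rats_subset_rat_adjoin int_imp_algebraic_int)
  ultimately show ?thesis
    unfolding prime_above_def using O.nonunit_in_prime_ideal by metis
qed

text \<open>The \<open>p\<close>-th power of \<open>x ^ p ^ n - x\<close> is \<open>p\<close> times
  an integer of the field, so it lies in any prime above \<open>p\<close>, and so does its base.
  Thus \<open>p ^ n\<close>-th powers are trivial on the residue ring.\<close>

lemma inertia_degree_dvd:
  assumes p: "Factorial_Ring.prime p" "odd p" "n > 0"
    and z: "z ^ m = 1" "\<And>j. 0 < j \<Longrightarrow> j < m \<Longrightarrow> z ^ j \<noteq> 1" and "m > 0"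
    and m: "m dvd p ^ n - 1 \<or> m dvd p ^ n + 1 \<or> m = p"
  shows "inertia_degree p (rat_adjoin (z + inverse z)) dvd n"
proof -
  define \<theta> where "\<theta> = z + inverse z"
  define E where "E = rat_adjoin \<theta>"
  define R where "R = integer_ring E"
  define P where "P = (SOME P. prime_above p E P)"
  have P: "prime_above p E P"
    unfolding P_def E_def using prime_above_exists[OF p(1)] by (rule someI_ex)
  interpret P: primeideal P R
    using P by (simp add: prime_above_def R_def)
  have p_P: "of_nat p \<in> P" using P by (simp add: prime_above_def)
  have "norm z ^ m = 1 ^ m"
    using z(1) by (simp flip: norm_power)
  then have norm_z: "norm z = 1"
    by (rule power_eq_imp_eq_base) (use \<open>m > 0\<close> in simp_all)
  have cnj: "cnj z = inverse z"
    using divide_conv_cnj[OF norm_z, of 1] by (simp add: inverse_eq_divide)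
  \<comment> \<open>A natural power in place of the inverse makes \<open>\<theta>\<close> a
    polynomial in \<open>z\<close>.\<close>
  have z_pow: "inverse z = z ^ (m - 1)"
    using z(1) \<open>m > 0\<close> by (intro inverse_unique) (simp flip: power_Suc)
  define t where "t = Polynomial.monom (1 :: rat) 1 + Polynomial.monom 1 (m - 1)"
  have \<theta>: "\<theta> = poly_rat t z"
    unfolding \<theta>_def t_def poly_rat_simps z_pow by simp
  have \<theta>_real: "\<theta> \<in> \<real>"
    unfolding \<theta>_def by (simp add: Reals_cnj_iff flip: cnj)
  define f0 where "f0 = Polynomial.monom (1 :: rat) m - 1"
  have f0: "f0 \<noteq> 0" "poly_rat f0 z = 0"
  proof -
    have "poly.coeff f0 m = 1" using \<open>m > 0\<close> by (simp add: f0_def)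
    then show "f0 \<noteq> 0" by auto
    show "poly_rat f0 z = 0" unfolding f0_def poly_rat_simps using z(1) by simp
  qed
  have R_simps: "carrier R = {x \<in> E. algebraic_int x}" "mult R = (*)" "one R = 1"
    "ring.zero R = 0" "add R = (+)"
    by (simp_all add: R_def)
  have R_pow: "x [^]\<^bsub>R\<^esub> k = x ^ k" for x and k :: nat
    by (induction k) (simp_all add: R_simps mult.commute)
  have R_minus: "x \<ominus>\<^bsub>R\<^esub> y = x - y" if "x \<in> carrier R" "y \<in> carrier R" for x y
  proof -
    have "- y \<in> carrier R" using that by (simp add: R_simps E_def rat_adjoin_uminus)
    then have "\<ominus>\<^bsub>R\<^esub> y = - y"
      using that by (intro P.minus_equality) (simp_all add: R_simps)
    then show ?thesis by (simp add: a_minus_def R_simps)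
  qed
  have prime_pow: "x \<in> P" if "x ^ k \<in> P" "x \<in> carrier R" for x k
    using that(1)
  proof (induction k)
    case 0
    then show ?case using P.one_imp_carrier P.I_notcarr by (simp add: R_simps)
  next
    case (Suc k)
    have "x ^ k \<in> carrier R"
      using that(2) P.nat_pow_closed[of x k] by (simp add: R_pow)
    then show ?case
      using Suc P.I_prime[OF that(2), of "x ^ k"] by (auto simp: R_simps)
  qed
  have frob: "x ^ p ^ n - x \<in> P" if x: "x \<in> carrier R" for x
  proof (rule prime_pow)
    have xE: "x \<in> E" "algebraic_int x" using x by (auto simp: R_simps)
    obtain h where h: "x = poly_rat h z"
      using rat_adjoin_subset_poly_rat[OF f0 \<theta> \<theta>_real] xE(1) unfolding E_def by blast
    have "x \<in> \<real>"
      using rat_adjoin_subset_Reals[OF f0 \<theta> \<theta>_real] xE(1) unfolding E_def by blast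
    then have "alg_cong p ((x ^ p ^ n - x) ^ p) 0"
      by (intro alg_cong_frobenius[OF p z \<open>m > 0\<close> m cnj h] xE)
    then obtain w where w: "algebraic_int w" "(x ^ p ^ n - x) ^ p = of_nat p * w"
      by (auto simp: alg_cong_def)
    have xd: "x ^ p ^ n - x \<in> E"
      unfolding E_def diff_conv_add_uminus
      using xE(1) by (intro rat_adjoin_add rat_adjoin_uminus rat_adjoin_power) (auto simp: E_def)
    then show "x ^ p ^ n - x \<in> carrier R"
      using xE(2) by (simp add: R_simps algebraic_int_diff algebraic_int_power)
    \<comment> \<open>So far \<open>w\<close> is merely a complex algebraic integer; dividing by
      \<open>p\<close> inside \<open>E\<close> puts it into the integer ring of
      \<open>E\<close>.\<close>
    have "w = (x ^ p ^ n - x) ^ p * inverse (of_nat p)"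
      using w(2) prime_gt_0_nat[OF p(1)] by (simp add: field_simps)
    also have "\<dots> \<in> E"
      using xd unfolding E_def
      by (rule rat_adjoin_mult[OF rat_adjoin_power Rats_subset_rat_adjoin]) simp
    finally have "w \<in> carrier R" using w(1) by (simp add: R_simps)
    then have "of_nat p * w \<in> P"
      using P.I_r_closed[OF p_P] by (simp add: R_simps)
    then show "(x ^ p ^ n - x) ^ p \<in> P" by (simp add: w(2))
  qed
  interpret Q: domain "R Quot P" by (rule P.quotient_is_domain)
  interpret hom: ring_hom_ring R "R Quot P" "(+>\<^bsub>R\<^esub>) P" by (rule P.rcos_ring_hom_ring)
  have hom_pow: "P +>\<^bsub>R\<^esub> (x ^ k) = (P +>\<^bsub>R\<^esub> x) [^]\<^bsub>R Quot P\<^esub> k" if "x \<in> carrier R" for x k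
  proof (induction k)
    case 0
    then show ?case using hom.hom_one by (simp add: R_simps)
  next
    case (Suc k)
    have "x ^ k \<in> carrier R" using that P.nat_pow_closed[of x k] by (simp add: R_pow)
    then show ?case
      using hom.hom_mult[of "x ^ k" x] that Suc by (simp add: R_simps mult.commute)
  qed
  have of_int_R: "of_int a \<in> carrier R" for a
    by (simp add: R_simps E_def Rats_subset_rat_adjoin int_imp_algebraic_int)
  have "Q.dim (generate_field (R Quot P) {}) (carrier (R Quot P)) dvd n"
  proof (rule Q.dim_prime_subfield_dvd[where h = "\<lambda>a. P +>\<^bsub>R\<^esub> of_int a" and p = p])
    show "P +>\<^bsub>R\<^esub> of_int 1 = \<one>\<^bsub>R Quot P\<^esub>"
      using hom.hom_one by (simp add: R_simps)
    show "P +>\<^bsub>R\<^esub> of_int (int p) = \<zero>\<^bsub>R Quot P\<^esub>"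
      unfolding of_int_of_nat_eq P.a_rcos_zero[OF P.is_ideal p_P] by (simp only: FactRing_def ring.simps)
    show "P +>\<^bsub>R\<^esub> of_int a \<in> carrier (R Quot P)" for a
      using of_int_R by (rule hom.hom_closed)
    show "P +>\<^bsub>R\<^esub> of_int (a + b) = (P +>\<^bsub>R\<^esub> of_int a) \<oplus>\<^bsub>R Quot P\<^esub> (P +>\<^bsub>R\<^esub> of_int b)" for a b
      using hom.hom_add[OF of_int_R[of a] of_int_R[of b]] by (simp add: R_simps)
    show "P +>\<^bsub>R\<^esub> of_int (a * b) = (P +>\<^bsub>R\<^esub> of_int a) \<otimes>\<^bsub>R Quot P\<^esub> (P +>\<^bsub>R\<^esub> of_int b)" for a b
      using hom.hom_mult[OF of_int_R[of a] of_int_R[of b]] by (simp add: R_simps)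
    fix y assume "y \<in> carrier (R Quot P)"
    then have "y \<in> (\<Union>x\<in>carrier R. {P +>\<^bsub>R\<^esub> x})"
      by (simp only: FactRing_def partial_object.simps A_RCOSETS_def')
    then obtain x where x: "x \<in> carrier R" "y = P +>\<^bsub>R\<^esub> x"
      by blast
    have "x ^ p ^ n \<in> carrier R" using x(1) P.nat_pow_closed[of x "p ^ n"] by (simp add: R_pow)
    then have "P +>\<^bsub>R\<^esub> (x ^ p ^ n) = P +>\<^bsub>R\<^esub> x"
      using frob[OF x(1)] P.quotient_eq_iff_same_a_r_cos[OF P.is_ideal, of "x ^ p ^ n" x] x(1)
      by (simp add: R_minus)
    then show "y [^]\<^bsub>R Quot P\<^esub> (p ^ n) = y"
      using x by (simp add: hom_pow)
  qed (use p in simp_all)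
  then show ?thesis
    unfolding inertia_degree_def residue_degree_def Let_def P_def E_def R_def \<theta>_def .
qed

section \<open>Finite fields and the trace polynomial\<close>

lemma CHAR_if_CARD_eq_prime_power:
  assumes p: "Factorial_Ring.prime p" and card: "CARD('a :: Fields.field) = p ^ n"
  shows "CHAR('a) = p"
proof -
  have "CARD('a) > 0" using card prime_gt_0_nat[OF p] by simp
  then have "finite (UNIV :: 'a set)" by (rule card_ge_0_finite)
  then have "CHAR('a) > 0" by (rule finite_imp_CHAR_pos)
  then have "Factorial_Ring.prime CHAR('a)" by (rule prime_CHAR_semidom)
  moreover have "CHAR('a) dvd p ^ n" using CHAR_dvd_CARD[where 'a = 'a] card by simp
  ultimately show ?thesis
    using p prime_dvd_power primes_dvd_imp_eq by blast
qed

lemma power_CARD_eq_self: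
  fixes x :: "'a :: Fields.field"
  assumes "finite (UNIV :: 'a set)"
  shows "x ^ CARD('a) = x"
proof -
  define R where "R = (ring_of_type_algebra :: 'a ring)"
  interpret R: field R
    unfolding R_def by (rule field_from_type_algebra)
  have R: "carrier R = UNIV" "mult R = (*)" "one R = 1"
    by (simp_all add: R_def ring_of_type_algebra_def)
  have pow: "x [^]\<^bsub>R\<^esub> k = x ^ k" for k :: nat
    by (induction k) (simp_all add: R mult.commute)
  show ?thesis
    using R.pow_card_eq_self[of x] assms by (simp add: R pow)
qed

text \<open>By Euler's criterion a square root \<open>s\<close> of 2 would satisfy
  \<open>s ^ p = - s\<close>. An odd number \<open>n\<close> of Frobenius steps still negates
  \<open>s\<close>, whereas the power \<open>p ^ n\<close> fixes it. The prime 2 is excluded because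
  2 is the square 0 modulo 2.\<close>

lemma two_not_square:
  fixes s :: "'a :: Fields.field"
  assumes p: "Factorial_Ring.prime p" and card: "CARD('a) = p ^ n" and "odd n"
    and qr: "\<not> QuadRes (int p) 2"
  shows "odd p" and "s ^ 2 \<noteq> 2"
proof -
  have "p \<noteq> 2"
  proof
    assume "p = 2"
    then have "QuadRes (int p) 2"
      unfolding QuadRes_def by (intro exI[of _ 0]) (simp add: Cong.cong_def)
    then show False using qr by contradiction
  qed
  then have "2 < p" using prime_ge_2_nat[OF p] by simp
  then show "odd p" using prime_odd_nat[OF p] by simp
  have CHAR: "CHAR('a) = p" using p card by (rule CHAR_if_CARD_eq_prime_power)
  have "finite (UNIV :: 'a set)"
    using card prime_gt_0_nat[OF p] by (intro card_ge_0_finite) simp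
  have two: "(2 :: 'a) \<noteq> 0"
  proof
    assume "(2 :: 'a) = 0"
    then have "of_nat 2 = (0 :: 'a)" by simp
    then have "p dvd 2" unfolding of_nat_eq_0_iff_char_dvd CHAR .
    then show False using \<open>2 < p\<close> by (auto dest: dvd_imp_le)
  qed
  show "s ^ 2 \<noteq> 2"
  proof
    assume s: "s ^ 2 = 2"
    have "\<not> [2 = 0] (mod int p)"
    proof
      assume "[2 = 0] (mod int p)"
      then have "int p dvd 2" by (simp add: cong_0_iff)
      then have "int p \<le> 2" by (rule zdvd_imp_le) simp
      then show False using \<open>2 < p\<close> by simp
    qed
    then have "Legendre 2 (int p) = - 1"
      using qr by (simp add: Legendre_def)
    then have "[2 ^ ((p - 1) div 2) = - 1] (mod int p)"
      using cong_sym[OF euler_criterion[OF p \<open>2 < p\<close>, of 2]] by simp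
    then have "int p dvd 2 ^ ((p - 1) div 2) - (- 1)"
      unfolding cong_iff_dvd_diff .
    then have "of_int (2 ^ ((p - 1) div 2) - (- 1)) = (0 :: 'a)"
      unfolding of_int_eq_0_iff_char_dvd CHAR .
    then have "(2 :: 'a) ^ ((p - 1) div 2) = - 1"
      by (simp add: eq_neg_iff_add_eq_0)
    then have "s ^ (2 * ((p - 1) div 2)) = - 1"
      by (simp only: power_mult s)
    moreover have "2 * ((p - 1) div 2) = p - 1" using \<open>odd p\<close> by simp
    ultimately have "s ^ (p - 1) = - 1" by simp
    then have "s ^ Suc (p - 1) = - s" by (simp only: power_Suc mult_minus_right mult_1_right)
    then have sp: "s ^ p = - s" using prime_gt_0_nat[OF p] by simp
    have "s ^ (p ^ k) = (- 1) ^ k * s" for k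
    proof (induction k)
      case (Suc k)
      have "s ^ (p ^ Suc k) = (s ^ (p ^ k)) ^ p"
        by (simp add: power_mult[symmetric] mult.commute)
      also have "\<dots> = ((- 1) ^ k) ^ p * s ^ p"
        by (simp add: Suc power_mult_distrib)
      also have "((- 1 :: 'a) ^ k) ^ p = (- 1) ^ k"
        using \<open>odd p\<close> by (cases "even k") simp_all
      finally show ?case by (simp add: sp)
    qed simp
    from this[of n] have "s ^ CARD('a) = - s"
      using \<open>odd n\<close> card by simp
    then have "s = - s"
      using power_CARD_eq_self[OF \<open>finite UNIV\<close>, of s] by simp
    then have "2 * s = 0" by (simp add: eq_neg_iff_add_eq_0)
    then show False using two s by auto
  qed
qed

text \<open>In terms of Chebyshev polynomials of the second kind, this is \<open>U\<^sub>k(c / 2) - U\<^sub>k\<^sub>-\<^sub>1(c / 2)\<close>.\<close>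
fun trace_factor :: "nat \<Rightarrow> 'a :: comm_ring_1 \<Rightarrow> 'a" where
  "trace_factor 0 c = 1"
| "trace_factor (Suc 0) c = c - 1"
| "trace_factor (Suc (Suc k)) c = c * trace_factor (Suc k) c - trace_factor k c"

lemma to_ac_trace_factor: "to_ac (trace_factor k c) = trace_factor k (to_ac c)"
  by (induction k c rule: trace_factor.induct) simp_all

text \<open>Cleared of denominators, so that the induction needs only
  \<open>z \<noteq> 0\<close>.\<close>

lemma trace_factor_eq:
  fixes z :: "'a :: Fields.field"
  assumes "z \<noteq> 0"
  shows "(z + 1) * z ^ k * trace_factor k (z + inverse z) = z ^ (2 * k + 1) + 1"
proof (induction k "z + inverse z" rule: trace_factor.induct)
  case 2
  then show ?case using assms by (simp add: field_simps power3_eq_cube numeral_3_eq_3)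
next
  case (3 k)
  let ?c = "z + inverse z"
  have "z * ?c = z ^ 2 + 1" using assms by (simp add: field_simps power2_eq_square)
  have "(z + 1) * z ^ Suc (Suc k) * trace_factor (Suc (Suc k)) ?c =
      (z * ?c) * ((z + 1) * z ^ Suc k * trace_factor (Suc k) ?c) -
      z ^ 2 * ((z + 1) * z ^ k * trace_factor k ?c)"
    by (simp add: algebra_simps power2_eq_square)
  also have "\<dots> = (z ^ 2 + 1) * (z ^ (2 * Suc k + 1) + 1) - z ^ 2 * (z ^ (2 * k + 1) + 1)"
    unfolding 3 \<open>z * ?c = z ^ 2 + 1\<close> ..
  also have "\<dots> = z ^ (2 * Suc (Suc k) + 1) + 1"
    by (simp add: algebra_simps power2_eq_square)
  finally show ?case .
qed simp

text \<open>This is the point \<open>z = - 1\<close>, where both sides of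
  \<open>trace_factor_eq\<close> vanish. Its value is the origin of the case
  \<open>m = p\<close>.\<close>

lemma trace_factor_minus_two:
  "trace_factor k (- 2 :: 'a :: comm_ring_1) = (- 1) ^ k * of_nat (2 * k + 1)"
proof (induction k "- 2 :: 'a" rule: trace_factor.induct)
  case (3 k)
  then show ?case
    unfolding trace_factor.simps by (simp only:) (simp add: algebra_simps)
qed simp_all

lemma power_gcd_eq_1:
  fixes x :: "'a :: Fields.field"
  assumes "x ^ a = 1" "x ^ b = 1" "a > 0"
  shows "x ^ gcd a b = 1"
proof -
  obtain u v where uv: "a * u = b * v + gcd a b"
    using bezout_nat[of a b] assms(3) by auto
  have "x ^ (a * u) = 1" "x ^ (b * v) = 1"
    using assms by (simp_all add: power_mult)
  then show ?thesis
    by (simp add: uv power_add)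
qed

text \<open>Two pairs with product 1 and equal sums are the roots of one quadratic, so they agree up
  to order.\<close>

lemma trace_eq_factorization:
  fixes a b y z :: "'a :: idom"
  assumes "a * b = 1" "z * y = 1"
  shows "(a - z) * (a * z - 1) = a * z * ((a + b) - (z + y))"
proof -
  have "a * z * ((a + b) - (z + y)) = a * a * z + (a * b) * z - a * z * z - a * (z * y)"
    by (simp add: algebra_simps)
  also have "\<dots> = (a - z) * (a * z - 1)"
    unfolding assms by (simp add: algebra_simps)
  finally show ?thesis ..
qed

lemma trace_factor_root:
  fixes c :: "'a :: Fields.field"
  assumes p: "Factorial_Ring.prime p" "odd p" "n > 0" and card: "CARD('a) = p ^ n"
    and c: "trace_factor K c = 0"
  obtains m where "m > 1" "m dvd 2 * K + 1" "m dvd p ^ n - 1 \<or> m dvd p ^ n + 1 \<or> m = p"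
proof -
  have CHAR: "CHAR('a) = p" using p(1) card by (rule CHAR_if_CARD_eq_prime_power)
  have "finite (UNIV :: 'a set)"
    using card prime_gt_0_nat[OF p(1)] by (intro card_ge_0_finite) simp
  then have "c ^ p ^ n = c"
    using power_CARD_eq_self[of c] card by simp
  then have cq: "to_ac c ^ p ^ n = to_ac c"
    by (simp flip: to_ac_power)
  \<comment> \<open>The equation \<open>c = z + 1 / z\<close> may be solvable only in a quadratic
    extension, hence the algebraic closure.\<close>
  obtain z where "poly [:1, - to_ac c, 1:] z = 0"
    using alg_closed_imp_poly_has_root[of "[:1, - to_ac c, 1:]"] by auto
  then have z_eq: "z * (to_ac c - z) = 1"
    by (simp add: algebra_simps eq_neg_iff_add_eq_0)
  then have "z \<noteq> 0" by auto
  have inv: "inverse z = to_ac c - z"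
    using z_eq by (rule inverse_unique)
  then have c_eq: "to_ac c = z + inverse z" by simp
  have "trace_factor K (z + inverse z) = 0"
    using c by (simp flip: c_eq to_ac_trace_factor)
  then have zK: "z ^ (2 * K + 1) = - 1"
    using trace_factor_eq[OF \<open>z \<noteq> 0\<close>, of K] by (simp add: eq_neg_iff_add_eq_0)
  have root: "(- z) ^ (2 * K + 1) = 1"
    using zK by simp
  show thesis
  proof (cases "z = - 1")
    case True
    then have "to_ac c = - 2" using c_eq by simp
    then have "trace_factor K (- 2 :: 'a alg_closure) = 0"
      using c to_ac_trace_factor[of K c] by simp
    then have "of_nat (2 * K + 1) = (0 :: 'a alg_closure)"
      by (simp only: trace_factor_minus_two mult_eq_0_iff) simp
    then have "p dvd 2 * K + 1"
      unfolding of_nat_eq_0_iff_char_dvd CHAR_alg_closure CHAR .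
    then show thesis using that[of p] prime_gt_1_nat[OF p(1)] by simp
  next
    case False
    have CHAR': "Factorial_Ring.prime CHAR('a alg_closure)" "p ^ n = CHAR('a alg_closure) ^ n"
      using p(1) by (simp_all add: CHAR)
    \<comment> \<open>Frobenius is additive and fixes \<open>c\<close>, so \<open>z ^ p ^ n\<close>
      is again a root of the quadratic of \<open>z\<close>.\<close>
    have "(z + inverse z) ^ p ^ n = z ^ p ^ n + inverse z ^ p ^ n"
      using CHAR' by (rule freshmans_dream')
    then have eq: "z ^ p ^ n + inverse (z ^ p ^ n) = z + inverse z"
      using cq by (simp add: c_eq power_inverse)
    let ?w = "z ^ p ^ n"
    have "?w \<noteq> 0" using \<open>z \<noteq> 0\<close> by simp
    have "(?w - z) * (?w * z - 1) = ?w * z * ((?w + inverse ?w) - (z + inverse z))"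
      by (rule trace_eq_factorization) (use \<open>z \<noteq> 0\<close> \<open>?w \<noteq> 0\<close> in simp_all)
    then have "?w = z \<or> ?w * z = 1"
      by (simp add: eq)
    moreover have "p ^ n > 0" using prime_gt_0_nat[OF p(1)] by simp
    ultimately have "z ^ (p ^ n - 1) = 1 \<or> z ^ (p ^ n + 1) = 1"
    proof (elim disjE)
      assume "?w = z"
      then have "z * z ^ (p ^ n - 1) = z * 1"
        using \<open>p ^ n > 0\<close> by (simp flip: power_Suc)
      then show ?thesis using \<open>z \<noteq> 0\<close> by (simp only: mult_cancel_left) simp
    next
      assume "?w * z = 1"
      then have "z ^ (p ^ n + 1) = 1" by (simp add: mult.commute)
      then show ?thesis ..
    qed
    \<comment> \<open>Even exponents carry the relation from \<open>z\<close> to \<open>- z\<close>,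
      which also has order dividing \<open>2 * K + 1\<close>. As \<open>- z\<close> is not 1, the
      gcd of the two exponents exceeds 1 and serves as \<open>m\<close>.\<close>
    moreover have "even (p ^ n - 1)" "even (p ^ n + 1)"
      using p(2) by simp_all
    ultimately obtain r where r: "r = p ^ n - 1 \<or> r = p ^ n + 1" "(- z) ^ r = 1"
      by (metis power_minus_even)
    have "(- z) ^ gcd (2 * K + 1) r = 1"
      by (rule power_gcd_eq_1[OF root r(2)]) simp
    then have "gcd (2 * K + 1) r \<noteq> 1"
      using False by (metis minus_minus power_one_right)
    then have "gcd (2 * K + 1) r > 1"
      by (metis add_eq_0_iff_both_eq_0 gcd_eq_0_iff less_one nat_neq_iff one_neq_zero)
    moreover have "gcd (2 * K + 1) r dvd 2 * K + 1" "gcd (2 * K + 1) r dvd r"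
      by simp_all
    ultimately show thesis using that r(1) by metis
  qed
qed

lemma zeta_power_eq_1_iff: "N > 0 \<Longrightarrow> zeta N ^ k = 1 \<longleftrightarrow> N dvd k"
  using complex_root_unity_eq_1[of N k] unfolding zeta_def
  by (simp add: exp_of_nat_mult[symmetric] mult_ac)

lemma trace_factor_neq_0:
  fixes c :: "'a :: Fields.field"
  assumes p: "Factorial_Ring.prime p" "odd p" "n > 0" and card: "CARD('a) = p ^ n"
    and inertia: "\<forall>i\<in>{1..K}. \<not> inertia_degree p
           (rat_adjoin (zeta (2 * K + 1) powi int i + zeta (2 * K + 1) powi (- int i))) dvd n"
  shows "trace_factor K c \<noteq> 0"
proof
  assume "trace_factor K c = 0"
  then obtain m where m: "m > 1" "m dvd 2 * K + 1" "m dvd p ^ n - 1 \<or> m dvd p ^ n + 1 \<or> m = p"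
    by (rule trace_factor_root[OF p card])
  \<comment> \<open>The cofactor selects the field in the hypothesis, since
    \<open>zeta (2 * K + 1) ^ i\<close> has order \<open>m\<close>. As \<open>m\<close> is odd and
    exceeds 1, it is at least 3, whence \<open>i \<le> K\<close>.\<close>
  obtain i where i: "2 * K + 1 = m * i" using m(2) by (rule dvdE)
  have "i > 0"
  proof (rule ccontr)
    assume "\<not> i > 0"
    then show False using i by simp
  qed
  have "m \<noteq> 2"
  proof
    assume "m = 2"
    then have "even (2 * K + 1)" unfolding i by simp
    then show False by simp
  qed
  then have "3 \<le> m" using m(1) by simp
  then have "3 * i \<le> 2 * K + 1" unfolding i by simp
  then have "i \<in> {1..K}" using \<open>i > 0\<close> by simp
  define z where "z = zeta (2 * K + 1) ^ i"
  have pow_z: "z ^ j = 1 \<longleftrightarrow> m dvd j" for j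
    using zeta_power_eq_1_iff[of "2 * K + 1" "i * j"] \<open>i > 0\<close> m(1)
    by (simp add: z_def power_mult[symmetric] i[simplified] mult.commute[of m i])
  have "inertia_degree p (rat_adjoin (z + inverse z)) dvd n"
    by (rule inertia_degree_dvd[OF p, of z m]) (use m pow_z in \<open>auto dest: dvd_imp_le\<close>)
  moreover have "z + inverse z = zeta (2 * K + 1) powi int i + zeta (2 * K + 1) powi (- int i)"
    by (simp add: z_def power_int_minus)
  ultimately show False
    using inertia \<open>i \<in> {1..K}\<close> by auto
qed

section \<open>Traces in the special linear group\<close>

hide_const (open) Matrix.mat Determinant.det
no_notation Matrix.vec_index (infixl \<open>$\<close> 100)
no_notation fps_nth (infixl \<open>$\<close> 75)

definition adjugate2 :: "'a :: Fields.field ^ 2 ^ 2 \<Rightarrow> 'a ^ 2 ^ 2" where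
  "adjugate2 A = vector [vector [A $ 2 $ 2, - A $ 1 $ 2], vector [- A $ 2 $ 1, A $ 1 $ 1]]"

lemma mat2_eq_iff:
  fixes A B :: "'a ^ 2 ^ 2"
  shows "A = B \<longleftrightarrow> A $ 1 $ 1 = B $ 1 $ 1 \<and> A $ 1 $ 2 = B $ 1 $ 2 \<and> A $ 2 $ 1 = B $ 2 $ 1 \<and> A $ 2 $ 2 = B $ 2 $ 2"
  by (simp only: Finite_Cartesian_Product.vec_eq_iff forall_2 conj_assoc)

lemma mat2_mult:
  fixes A B :: "'a :: semiring_1 ^ 2 ^ 2"
  shows "(A ** B) $ i $ j = A $ i $ 1 * B $ 1 $ j + A $ i $ 2 * B $ 2 $ j"
  by (simp add: matrix_matrix_mult_def sum_2)

lemma mat2_one: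
  "(mat 1 :: 'a :: semiring_1 ^ 2 ^ 2) $ 1 $ 1 = 1" "(mat 1 :: 'a ^ 2 ^ 2) $ 1 $ 2 = 0"
  "(mat 1 :: 'a ^ 2 ^ 2) $ 2 $ 1 = 0" "(mat 1 :: 'a ^ 2 ^ 2) $ 2 $ 2 = 1"
  by (simp_all add: Finite_Cartesian_Product.mat_def)

lemma trace2: "trace (A :: 'a :: semiring_1 ^ 2 ^ 2) = A $ 1 $ 1 + A $ 2 $ 2"
  by (simp add: trace_def sum_2)

lemma adjugate2_nth [simp]:
  "adjugate2 A $ 1 $ 1 = A $ 2 $ 2" "adjugate2 A $ 1 $ 2 = - A $ 1 $ 2"
  "adjugate2 A $ 2 $ 1 = - A $ 2 $ 1" "adjugate2 A $ 2 $ 2 = A $ 1 $ 1"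
  by (simp_all add: adjugate2_def)

lemma SL_simps [simp]:
  "carrier (SL :: ('a :: Fields.field ^ 'n ^ 'n) monoid) = {A. det A = 1}"
  "mult (SL :: ('a ^ 'n ^ 'n) monoid) = (**)" "one (SL :: ('a ^ 'n ^ 'n) monoid) = mat 1"
  by (simp_all add: SL_def)

lemma det_adjugate2: "det (adjugate2 A) = det A"
  by (simp add: det_2 mult.commute)

lemma adjugate2_mult: "det A = 1 \<Longrightarrow> adjugate2 A ** A = mat 1"
  by (simp add: mat2_eq_iff mat2_mult mat2_one det_2 algebra_simps)

lemma group_SL2: "group (SL :: ('a :: Fields.field ^ 2 ^ 2) monoid)"
proof (rule groupI)
  fix A :: "'a ^ 2 ^ 2"
  assume "A \<in> carrier SL"
  then show "\<exists>B\<in>carrier SL. B \<otimes>\<^bsub>SL\<^esub> A = \<one>\<^bsub>SL\<^esub>"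
    by (intro bexI[of _ "adjugate2 A"]) (simp_all add: adjugate2_mult det_adjugate2)
qed (simp_all add: det_mul matrix_mul_assoc)

lemma inv_SL2:
  fixes A :: "'a :: Fields.field ^ 2 ^ 2"
  assumes "det A = 1"
  shows "inv\<^bsub>SL\<^esub> A = adjugate2 A"
  by (rule group.inv_equality[OF group_SL2]) (simp_all add: assms adjugate2_mult det_adjugate2)

lemma trace_inv_SL2:
  "(A :: 'a :: Fields.field ^ 2 ^ 2) \<in> carrier SL \<Longrightarrow> trace (inv\<^bsub>SL\<^esub> A) = trace A"
  by (simp add: inv_SL2 trace2 add.commute)

lemma trace_mult_commute:
  "trace (A \<otimes>\<^bsub>SL\<^esub> B) = trace (B \<otimes>\<^bsub>SL\<^esub> (A :: 'a :: Fields.field ^ 2 ^ 2))"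
  unfolding SL_simps by (rule trace_mul_sym)

text \<open>By Cayley-Hamilton in determinant 1, \<open>A\<close> and its inverse add up to the
  scalar \<open>trace A\<close>.\<close>

lemma trace_mult_add_trace_inv_mult:
  fixes A B :: "'a :: Fields.field ^ 2 ^ 2"
  assumes "A \<in> carrier SL"
  shows "trace (A \<otimes>\<^bsub>SL\<^esub> B) + trace (inv\<^bsub>SL\<^esub> A \<otimes>\<^bsub>SL\<^esub> B) = trace A * trace B"
  using assms by (simp add: inv_SL2 trace2 mat2_mult algebra_simps)

lemma trace_square:
  fixes A :: "'a :: Fields.field ^ 2 ^ 2"
  assumes "A \<in> carrier SL"
  shows "trace (A \<otimes>\<^bsub>SL\<^esub> A) = trace A ^ 2 - 2"
  using trace_mult_add_trace_inv_mult[OF assms, of A] group.l_inv[OF group_SL2 assms]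
  by (simp add: trace2 mat2_one power2_eq_square algebra_simps)

lemma trace_mult_pow_recurrence:
  fixes A C :: "'a :: Fields.field ^ 2 ^ 2"
  assumes "A \<in> carrier SL" "C \<in> carrier SL"
  shows "trace (A \<otimes>\<^bsub>SL\<^esub> C [^]\<^bsub>SL\<^esub> Suc (Suc k)) =
    trace C * trace (A \<otimes>\<^bsub>SL\<^esub> C [^]\<^bsub>SL\<^esub> Suc k) - trace (A \<otimes>\<^bsub>SL\<^esub> C [^]\<^bsub>SL\<^esub> (k :: nat))"
proof -
  interpret group "SL :: ('a ^ 2 ^ 2) monoid" by (rule group_SL2)
  let ?D = "A \<otimes>\<^bsub>SL\<^esub> C [^]\<^bsub>SL\<^esub> Suc k"
  have D: "?D \<in> carrier SL" using assms by (intro m_closed nat_pow_closed)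
  have "trace (C \<otimes>\<^bsub>SL\<^esub> ?D) + trace (inv\<^bsub>SL\<^esub> C \<otimes>\<^bsub>SL\<^esub> ?D) = trace C * trace ?D"
    by (rule trace_mult_add_trace_inv_mult[OF assms(2)])
  moreover have "trace (C \<otimes>\<^bsub>SL\<^esub> ?D) = trace (A \<otimes>\<^bsub>SL\<^esub> C [^]\<^bsub>SL\<^esub> Suc (Suc k))"
    using assms by (subst trace_mult_commute) (simp only: nat_pow_Suc m_assoc m_closed nat_pow_closed)
  moreover have "?D \<otimes>\<^bsub>SL\<^esub> inv\<^bsub>SL\<^esub> C = A \<otimes>\<^bsub>SL\<^esub> C [^]\<^bsub>SL\<^esub> k"
    using assms by (simp only: nat_pow_Suc m_assoc m_closed nat_pow_closed inv_closed r_inv r_one)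
  then have "trace (inv\<^bsub>SL\<^esub> C \<otimes>\<^bsub>SL\<^esub> ?D) = trace (A \<otimes>\<^bsub>SL\<^esub> C [^]\<^bsub>SL\<^esub> k)"
    by (subst trace_mult_commute) (simp only:)
  ultimately show ?thesis by (simp only: eq_diff_eq)
qed

lemma trace_factor_recurrence:
  assumes "s 0 = a" "s (Suc 0) = a * (c - 1)" "\<And>k. s (Suc (Suc k)) = c * s (Suc k) - s k"
  shows "s k = a * trace_factor k c"
  by (induction k rule: induct_nat_012) (simp_all add: assms algebra_simps)

text \<open>Here \<open>C\<close> is the product of \<open>A\<close> and a conjugate
  \<open>B\<close> of \<open>x\<close> to the power \<open>2 * \<delta>\<close>, and
  \<open>B\<close> has the trace of \<open>A\<close> for either sign of \<open>\<delta>\<close>. So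
  \<open>inv A\<close> and \<open>inv A\<close> times \<open>C\<close>, which is \<open>B\<close>,
  both have the trace of \<open>A\<close>, and the second sequence lags one step behind the first.
  This lag is the shift between \<open>k\<close> and \<open>k\<^sub>\<epsilon>\<close>.\<close>

lemma trace_word:
  fixes x y :: "'a :: Fields.field ^ 2 ^ 2" and \<delta> :: int
  assumes x: "x \<in> carrier SL" and y: "y \<in> carrier SL" and \<delta>: "\<delta> \<in> {1, -1}"
  defines "A \<equiv> x [^]\<^bsub>SL\<^esub> (2 :: int)"
  defines "C \<equiv> A \<otimes>\<^bsub>SL\<^esub> y \<otimes>\<^bsub>SL\<^esub> x [^]\<^bsub>SL\<^esub> (2 * \<delta>) \<otimes>\<^bsub>SL\<^esub> inv\<^bsub>SL\<^esub> y"
  shows "trace (A \<otimes>\<^bsub>SL\<^esub> C [^]\<^bsub>SL\<^esub> k) = trace A * trace_factor k (trace C)"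
    and "trace (inv\<^bsub>SL\<^esub> A \<otimes>\<^bsub>SL\<^esub> C [^]\<^bsub>SL\<^esub> Suc k) = trace A * trace_factor k (trace C)"
proof -
  interpret group "SL :: ('a ^ 2 ^ 2) monoid" by (rule group_SL2)
  have A: "A \<in> carrier SL" unfolding A_def using x by (rule int_pow_closed)
  define B where "B = y \<otimes>\<^bsub>SL\<^esub> x [^]\<^bsub>SL\<^esub> (2 * \<delta>) \<otimes>\<^bsub>SL\<^esub> inv\<^bsub>SL\<^esub> y"
  have B: "B \<in> carrier SL"
    unfolding B_def using x y by (intro m_closed inv_closed int_pow_closed)
  have C_eq: "C = A \<otimes>\<^bsub>SL\<^esub> B"
    unfolding C_def B_def using A x y by (simp only: m_assoc m_closed inv_closed int_pow_closed)
  then have C: "C \<in> carrier SL" using A B by (simp only: m_closed)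
  have "trace (x [^]\<^bsub>SL\<^esub> (2 * \<delta>)) = trace A"
    using \<delta>
  proof (elim insertE)
    assume "\<delta> = - 1"
    then have "x [^]\<^bsub>SL\<^esub> (2 * \<delta>) = inv\<^bsub>SL\<^esub> A"
      unfolding A_def using int_pow_neg[OF x, of 2] by simp
    then show ?thesis using trace_inv_SL2[OF A] by simp
  qed (simp_all add: A_def)
  moreover have "trace B = trace (x [^]\<^bsub>SL\<^esub> (2 * \<delta>))"
  proof -
    have "inv\<^bsub>SL\<^esub> y \<otimes>\<^bsub>SL\<^esub> (y \<otimes>\<^bsub>SL\<^esub> x [^]\<^bsub>SL\<^esub> (2 * \<delta>)) = x [^]\<^bsub>SL\<^esub> (2 * \<delta>)"
      using x y by (simp only: m_assoc[symmetric] inv_closed int_pow_closed l_inv l_one)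
    then show ?thesis
      unfolding B_def by (subst trace_mult_commute) (simp only:)
  qed
  ultimately have trace_B: "trace B = trace A" by simp
  have invA_C: "inv\<^bsub>SL\<^esub> A \<otimes>\<^bsub>SL\<^esub> C = B"
    unfolding C_eq using A B by (simp only: m_assoc[symmetric] inv_closed l_inv l_one)
  have AC: "trace (A \<otimes>\<^bsub>SL\<^esub> C) = trace A * (trace C - 1)"
    using trace_mult_add_trace_inv_mult[OF A, of C] invA_C trace_B by (simp add: algebra_simps)
  show "trace (A \<otimes>\<^bsub>SL\<^esub> C [^]\<^bsub>SL\<^esub> k) = trace A * trace_factor k (trace C)"
  proof (rule trace_factor_recurrence)
    show "trace (A \<otimes>\<^bsub>SL\<^esub> C [^]\<^bsub>SL\<^esub> (0 :: nat)) = trace A"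
      using A by (simp only: nat_pow_0 r_one)
    show "trace (A \<otimes>\<^bsub>SL\<^esub> C [^]\<^bsub>SL\<^esub> Suc 0) = trace A * (trace C - 1)"
      using C AC by (simp only: nat_pow_Suc nat_pow_0 l_one)
  qed (rule trace_mult_pow_recurrence[OF A C])
  have iA: "inv\<^bsub>SL\<^esub> A \<in> carrier SL" using A by (rule inv_closed)
  have 0: "trace (inv\<^bsub>SL\<^esub> A \<otimes>\<^bsub>SL\<^esub> C [^]\<^bsub>SL\<^esub> (0 :: nat)) = trace A"
    using iA trace_inv_SL2[OF A] by (simp only: nat_pow_0 r_one)
  have 1: "trace (inv\<^bsub>SL\<^esub> A \<otimes>\<^bsub>SL\<^esub> C [^]\<^bsub>SL\<^esub> Suc 0) = trace A"
    using C invA_C trace_B by (simp only: nat_pow_Suc nat_pow_0 l_one)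
  show "trace (inv\<^bsub>SL\<^esub> A \<otimes>\<^bsub>SL\<^esub> C [^]\<^bsub>SL\<^esub> Suc k) = trace A * trace_factor k (trace C)"
  proof (rule trace_factor_recurrence[where s = "\<lambda>k. trace (inv\<^bsub>SL\<^esub> A \<otimes>\<^bsub>SL\<^esub> C [^]\<^bsub>SL\<^esub> Suc k)"])
    show "trace (inv\<^bsub>SL\<^esub> A \<otimes>\<^bsub>SL\<^esub> C [^]\<^bsub>SL\<^esub> Suc (Suc 0)) = trace A * (trace C - 1)"
      unfolding trace_mult_pow_recurrence[OF iA C] 0 1 by (simp add: algebra_simps)
  qed (rule 1, rule trace_mult_pow_recurrence[OF iA C])
qed

section \<open>Passage from SL to PSL\<close>

lemma (in group) group_centre_normal: "group_centre G \<lhd> G"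
proof -
  have inv_comm: "inv z \<otimes> g = g \<otimes> inv z"
    if "z \<in> carrier G" "g \<in> carrier G" "z \<otimes> g = g \<otimes> z" for z g
  proof -
    have "inv z \<otimes> g = inv z \<otimes> (g \<otimes> z) \<otimes> inv z"
      using that(1,2) by (simp add: m_assoc)
    also have "\<dots> = g \<otimes> inv z"
      using that by (simp add: m_assoc[symmetric] that(3)[symmetric])
    finally show ?thesis .
  qed
  show ?thesis
    unfolding normal_inv_iff
  proof (intro conjI ballI)
    show "subgroup (group_centre G) G"
    proof (rule subgroupI)
      show "group_centre G \<noteq> {}"
        by (auto simp: group_centre_def intro!: exI[of _ \<one>])
      fix z z' assume z: "z \<in> group_centre G" "z' \<in> group_centre G"
      then have c: "z \<in> carrier G" "z' \<in> carrier G" by (auto simp: group_centre_def)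
      have comm: "z \<otimes> g = g \<otimes> z" "z' \<otimes> g = g \<otimes> z'" if "g \<in> carrier G" for g
        using z that unfolding group_centre_def by blast+
      have "z \<otimes> z' \<otimes> g = g \<otimes> (z \<otimes> z')" if g: "g \<in> carrier G" for g
      proof -
        have "z \<otimes> z' \<otimes> g = z \<otimes> (z' \<otimes> g)" using c g by (rule m_assoc)
        also have "\<dots> = z \<otimes> (g \<otimes> z')" by (simp only: comm(2)[OF g])
        also have "\<dots> = z \<otimes> g \<otimes> z'" using c g by (simp only: m_assoc)
        also have "\<dots> = g \<otimes> z \<otimes> z'" by (simp only: comm(1)[OF g])
        also have "\<dots> = g \<otimes> (z \<otimes> z')" using c g by (simp only: m_assoc)
        finally show ?thesis .
      qed
      then show "z \<otimes> z' \<in> group_centre G"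
        using c by (simp add: group_centre_def)
    qed (auto simp: group_centre_def inv_comm)
    fix x z assume x: "x \<in> carrier G" and "z \<in> group_centre G"
    then have z: "z \<in> carrier G" and "x \<otimes> z = z \<otimes> x"
      unfolding group_centre_def by force+
    then have "x \<otimes> z \<otimes> inv x = z"
      using x by (simp only: m_assoc inv_closed r_inv r_one)
    then show "x \<otimes> z \<otimes> inv x \<in> group_centre G"
      using \<open>z \<in> group_centre G\<close> by simp
  qed
qed

lemma word_eval_hom_image:
  assumes "group G" "group H" "h \<in> hom G H" "range f \<subseteq> carrier G"
  shows "word_eval H (\<lambda>g. h (f g)) w = h (word_eval G f w)"
proof -
  interpret group_hom G H h
    using assms(1-3) by (simp add: group_hom_def group_hom_axioms_def)
  have f: "f g \<in> carrier G" for g using assms(4) by auto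
  have closed: "word_eval G f w \<in> carrier G" for w
    by (rule word_eval_closed[OF assms(1,4)])
  show ?thesis
  proof (induction w)
    case Nil
    show ?case by (simp add: word_eval_def)
  next
    case (Cons a w)
    obtain g b where a: "a = (g, b)" by (cases a)
    have eval_Cons: "word_eval K k ((g, b) # v) =
        (if b then inv\<^bsub>K\<^esub> (k g) else k g) \<otimes>\<^bsub>K\<^esub> word_eval K k v" for K :: "('x, 'y) monoid_scheme" and k v
      by (simp add: word_eval_def)
    show ?case
      unfolding a eval_Cons Cons using f closed by simp
  qed
qed

section \<open>The word map\<close>

text \<open>Commuting with the two elementary matrices forces \<open>z\<close> to be scalar.\<close>

lemma centre_SL2_trace:
  fixes z :: "'a :: Fields.field ^ 2 ^ 2"
  assumes "z \<in> group_centre SL" and J: "J \<in> carrier SL" "trace J = 0"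
  shows "trace (z \<otimes>\<^bsub>SL\<^esub> J) = 0"
proof -
  define T :: "'a ^ 2 ^ 2" where "T = vector [vector [1, 1], vector [0, 1]]"
  define L :: "'a ^ 2 ^ 2" where "L = vector [vector [1, 0], vector [1, 1]]"
  have T: "T $ 1 $ 1 = 1" "T $ 1 $ 2 = 1" "T $ 2 $ 1 = 0" "T $ 2 $ 2 = 1"
    by (simp_all add: T_def)
  have L: "L $ 1 $ 1 = 1" "L $ 1 $ 2 = 0" "L $ 2 $ 1 = 1" "L $ 2 $ 2 = 1"
    by (simp_all add: L_def)
  have comm: "z ** g = g ** z" if "det g = 1" for g
    using assms(1) that by (simp add: group_centre_def)
  have "z ** T = T ** z" by (rule comm) (simp add: det_2 T)
  then have "z $ 2 $ 1 = 0" and "z $ 1 $ 1 = z $ 2 $ 2"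
    unfolding mat2_eq_iff mat2_mult T by simp_all
  moreover have "z ** L = L ** z" by (rule comm) (simp add: det_2 L)
  then have "z $ 1 $ 2 = 0"
    unfolding mat2_eq_iff mat2_mult L by simp
  ultimately have "trace (z \<otimes>\<^bsub>SL\<^esub> J) = z $ 1 $ 1 * trace J"
    by (simp add: trace2 mat2_mult distrib_left)
  then show ?thesis using J(2) by simp
qed

text \<open>A preimage of the class of the trace-zero matrix \<open>J\<close> lifts to SL, where the
  value of the word differs from \<open>J\<close> by a central factor only.\<close>

lemma PSL_word_map_trace:
  fixes w :: "gen2 word"
  assumes surj: "word_map (PSL :: ('a :: Fields.field ^ 2 ^ 2) set monoid) w `
      (carrier (PSL :: ('a ^ 2 ^ 2) set monoid) \<times> carrier (PSL :: ('a ^ 2 ^ 2) set monoid)) =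
      carrier (PSL :: ('a ^ 2 ^ 2) set monoid)"
  obtains x y :: "'a :: Fields.field ^ 2 ^ 2" where "x \<in> carrier SL" "y \<in> carrier SL"
    "trace (word_eval SL (case_gen2 x y) w) = 0"
proof -
  let ?Z = "group_centre (SL :: ('a ^ 2 ^ 2) monoid)"
  interpret S: group "SL :: ('a ^ 2 ^ 2) monoid" by (rule group_SL2)
  interpret Z: normal ?Z SL by (rule S.group_centre_normal)
  define h where "h = (\<lambda>A. ?Z #>\<^bsub>SL\<^esub> A)"
  have hom: "h \<in> hom SL PSL"
    unfolding h_def PSL_def by (rule Z.r_coset_hom_Mod)
  have grp: "group (PSL :: ('a ^ 2 ^ 2) set monoid)"
    unfolding PSL_def by (rule Z.factorgroup_is_group)
  have carrier_PSL: "carrier PSL = h ` carrier SL"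
    by (auto simp: PSL_def h_def carrier_FactGroup)
  define J :: "'a ^ 2 ^ 2" where "J = vector [vector [0, 1], vector [-1, 0]]"
  have J: "J \<in> carrier SL" "trace J = 0"
    by (simp_all add: J_def det_2 trace2)
  have "h J \<in> carrier PSL" unfolding carrier_PSL using J(1) by (rule imageI)
  then have "h J \<in> word_map PSL w ` (carrier PSL \<times> carrier PSL)"
    unfolding surj .
  then obtain x y where xy: "x \<in> carrier SL" "y \<in> carrier SL" "h J = word_map PSL w (h x, h y)"
    unfolding carrier_PSL by blast
  define f where "f = case_gen2 x y"
  have f: "range f \<subseteq> carrier SL"
    using xy(1,2) by (auto simp: f_def split: gen2.split)
  have "case_gen2 (h x) (h y) = (\<lambda>g. h (f g))"
    by (auto simp: f_def fun_eq_iff split: gen2.split)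
  then have "h J = h (word_eval SL f w)"
    using xy(3) word_eval_hom_image[OF group_SL2 grp hom f, of w] by (simp add: word_map_def)
  moreover have W: "word_eval SL f w \<in> carrier SL"
    by (rule word_eval_closed[OF group_SL2 f])
  ultimately have "word_eval SL f w \<in> ?Z #>\<^bsub>SL\<^esub> J"
    using S.rcos_self[OF W Z.is_subgroup] by (simp only: h_def)
  then obtain z where "z \<in> ?Z" "word_eval SL f w = z \<otimes>\<^bsub>SL\<^esub> J"
    by (auto simp only: r_coset_def)
  then have "trace (word_eval SL f w) = 0"
    using centre_SL2_trace[OF _ J] by simp
  then show thesis
    using that[OF xy(1,2)] by (simp add: f_def)
qed

lemma word_eval_y_word:
  fixes G (structure)
  assumes "group G" and xy: "x \<in> carrier G" "y \<in> carrier G"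
  shows "word_eval G (case_gen2 x y) (x1 [^]\<^bsub>F2\<^esub> (a :: int) \<otimes>\<^bsub>F2\<^esub> y_word \<delta> k) =
    x [^] a \<otimes> (x [^] (2 :: int) \<otimes> y \<otimes> x [^] (2 * \<delta>) \<otimes> inv y) [^] k"
proof -
  let ?f = "case_gen2 x y"
  have f: "range ?f \<subseteq> carrier G"
    using xy by (auto split: gen2.split)
  interpret group_hom F2 G "word_eval G ?f"
    using group_free_group assms(1) word_eval_hom[OF assms(1) f]
    by (simp add: group_hom_def group_hom_axioms_def)
  have gens: "x1 \<in> carrier F2" "x2 \<in> carrier F2"
    by (simp_all add: x1_def x2_def free_group_def freely_reduced_Cons)
  have eval: "word_eval G ?f x1 = x" "word_eval G ?f x2 = y"
    using xy by (simp_all add: word_eval_def x1_def x2_def)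
  show ?thesis
    unfolding y_word_def using gens
    by (simp only: hom_mult hom_int_pow hom_inv G.m_closed G.int_pow_closed G.inv_closed eval)
qed

theorem theorem3p1:
  fixes \<delta> \<epsilon> k :: int and k\<^sub>\<epsilon> p n :: nat and w :: "gen2 word"
  assumes "\<delta> \<in> {1, -1}"
    and "\<epsilon> \<in> {1, -1}"
    and "real k\<^sub>\<epsilon> = of_int k - 1 / 2 + of_int \<epsilon> / 2"
    and "k\<^sub>\<epsilon> \<ge> 1"
    and "Factorial_Ring.prime p"
    and "n > 0"
    and "\<not> QuadRes (int p) 2"
    and "odd n"
    and "\<forall>i\<in>{1..k\<^sub>\<epsilon>}. \<not> inertia_degree p
           (rat_adjoin (zeta (2 * k\<^sub>\<epsilon> + 1) powi int i + zeta (2 * k\<^sub>\<epsilon> + 1) powi (- int i))) dvd n"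
    and "w \<in> {x1 [^]\<^bsub>F2\<^esub> (2 * \<epsilon>) \<otimes>\<^bsub>F2\<^esub> y_word \<delta> k, x1 [^]\<^bsub>F2\<^esub> (2::int) \<otimes>\<^bsub>F2\<^esub> y_word \<delta> (\<epsilon> * k)}"
    and "CARD('a::field) = p ^ n"
  shows "word_map (PSL :: ('a ^ 2 ^ 2) set monoid) w
           ` (carrier (PSL :: ('a ^ 2 ^ 2) set monoid) \<times> carrier (PSL :: ('a ^ 2 ^ 2) set monoid))
         \<noteq> carrier (PSL :: ('a ^ 2 ^ 2) set monoid)"
proof
  assume "word_map (PSL :: ('a ^ 2 ^ 2) set monoid) w
           ` (carrier (PSL :: ('a ^ 2 ^ 2) set monoid) \<times> carrier (PSL :: ('a ^ 2 ^ 2) set monoid))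
         = carrier (PSL :: ('a ^ 2 ^ 2) set monoid)"
  then obtain x y :: "'a ^ 2 ^ 2" where x: "x \<in> carrier SL" and y: "y \<in> carrier SL"
    and tr0: "trace (word_eval SL (case_gen2 x y) w) = 0"
    by (rule PSL_word_map_trace)
  interpret group "SL :: ('a ^ 2 ^ 2) monoid" by (rule group_SL2)
  define A where "A = x [^]\<^bsub>SL\<^esub> (2 :: int)"
  define C where "C = A \<otimes>\<^bsub>SL\<^esub> y \<otimes>\<^bsub>SL\<^esub> x [^]\<^bsub>SL\<^esub> (2 * \<delta>) \<otimes>\<^bsub>SL\<^esub> inv\<^bsub>SL\<^esub> y"
  have A: "A \<in> carrier SL" unfolding A_def using x by (rule int_pow_closed)
  have C: "C \<in> carrier SL"
    unfolding C_def using A x y by (intro m_closed inv_closed int_pow_closed)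
  note traces = trace_word[OF x y assms(1), folded A_def, folded C_def]
  note evals = word_eval_y_word[OF group_SL2 x y, of _ \<delta>, folded A_def, folded C_def]
  have "trace (word_eval SL (case_gen2 x y) w) = trace A * trace_factor k\<^sub>\<epsilon> (trace C)"
    using assms(2)
  proof (elim insertE)
    assume \<epsilon>: "\<epsilon> = 1"
    then have "k = int k\<^sub>\<epsilon>" using assms(3) by linarith
    then have "word_eval SL (case_gen2 x y) w = A \<otimes>\<^bsub>SL\<^esub> C [^]\<^bsub>SL\<^esub> k\<^sub>\<epsilon>"
      using assms(10) evals[of 2 k] by (auto simp only: \<epsilon> mult_1_left mult_1_right int_pow_int A_def)
    then show ?thesis by (simp only: traces)
  next
    assume \<epsilon>: "\<epsilon> = - 1"
    \<comment> \<open>The extra step matches the lag of the traces with \<open>inv A\<close> in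
      \<open>trace_word\<close>.\<close>
    then have k: "k = int (Suc k\<^sub>\<epsilon>)" using assms(3) by linarith
    have Ck: "C [^]\<^bsub>SL\<^esub> Suc k\<^sub>\<epsilon> \<in> carrier SL" using C by (rule nat_pow_closed)
    have inv_A: "inv\<^bsub>SL\<^esub> A \<in> carrier SL" using A by (rule inv_closed)
    have neg2: "x [^]\<^bsub>SL\<^esub> (- 2 :: int) = inv\<^bsub>SL\<^esub> A"
      unfolding A_def using x by (rule int_pow_neg)
    have "w = x1 [^]\<^bsub>F2\<^esub> (- 2 :: int) \<otimes>\<^bsub>F2\<^esub> y_word \<delta> k \<or>
        w = x1 [^]\<^bsub>F2\<^esub> (2 :: int) \<otimes>\<^bsub>F2\<^esub> y_word \<delta> (- k)"
      using assms(10) by (simp add: \<epsilon>)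
    then show ?thesis
    proof
      assume "w = x1 [^]\<^bsub>F2\<^esub> (- 2 :: int) \<otimes>\<^bsub>F2\<^esub> y_word \<delta> k"
      then have "word_eval SL (case_gen2 x y) w = inv\<^bsub>SL\<^esub> A \<otimes>\<^bsub>SL\<^esub> C [^]\<^bsub>SL\<^esub> Suc k\<^sub>\<epsilon>"
        by (simp only: evals neg2 k int_pow_int)
      then show ?thesis by (simp only: traces)
    next
      assume "w = x1 [^]\<^bsub>F2\<^esub> (2 :: int) \<otimes>\<^bsub>F2\<^esub> y_word \<delta> (- k)"
      then have "word_eval SL (case_gen2 x y) w = A \<otimes>\<^bsub>SL\<^esub> inv\<^bsub>SL\<^esub> (C [^]\<^bsub>SL\<^esub> Suc k\<^sub>\<epsilon>)"
        using C by (simp only: evals A_def[symmetric] k int_pow_neg int_pow_int)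
      \<comment> \<open>Inversion and cyclic rotation preserve the trace, so this word reduces to
        the previous one.\<close>
      also have "\<dots> = inv\<^bsub>SL\<^esub> (C [^]\<^bsub>SL\<^esub> Suc k\<^sub>\<epsilon> \<otimes>\<^bsub>SL\<^esub> inv\<^bsub>SL\<^esub> A)"
        using A Ck inv_A by (simp only: inv_mult_group inv_inv)
      finally have "trace (word_eval SL (case_gen2 x y) w) =
          trace (C [^]\<^bsub>SL\<^esub> Suc k\<^sub>\<epsilon> \<otimes>\<^bsub>SL\<^esub> inv\<^bsub>SL\<^esub> A)"
        using Ck inv_A by (simp only: trace_inv_SL2 m_closed)
      also have "\<dots> = trace (inv\<^bsub>SL\<^esub> A \<otimes>\<^bsub>SL\<^esub> C [^]\<^bsub>SL\<^esub> Suc k\<^sub>\<epsilon>)"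
        by (rule trace_mult_commute)
      finally show ?thesis by (simp only: traces)
    qed
  qed simp
  then have "trace A = 0 \<or> trace_factor k\<^sub>\<epsilon> (trace C) = 0"
    using tr0 by simp
  moreover have "odd p" and not_square: "trace x ^ 2 \<noteq> 2"
    using two_not_square[OF assms(5,11,8,7)] by blast+
  moreover have "trace_factor k\<^sub>\<epsilon> (trace C) \<noteq> 0"
    by (rule trace_factor_neq_0[OF assms(5) \<open>odd p\<close> assms(6,11,9)])
  moreover have "trace A = trace x ^ 2 - 2"
  proof -
    have "A = x \<otimes>\<^bsub>SL\<^esub> x"
      unfolding A_def using x int_pow_int[of SL x 2] by (simp add: numeral_2_eq_2)
    then show ?thesis using trace_square[OF x] by simp
  qed
  ultimately show False by simp
qed

end
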